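(* If $T$ is a (finite) tree, then $ub(T)=\Upsilon_{ub}(T)$.
   Context: A bar is a closed horizontal line segment of length $1$ in the plane. Two bars of an arrangement of pairwise disjoint bars see each other if there is an axis-parallel rectangle of positive width whose bottom side lies in one of them, whose top side lies in the other, and whose interior meets no bar of the arrangement. For a nonnegative integer $t$, a $t$-unit-bar visibility representation of a graph $G$ assigns to each vertex a set of at most $t$ bars, all bars pairwise disjoint, such that two distinct vertices are adjacent iff some bar of one sees some bar of the other; $ub(G)$ is the minimum such $t$. A unit bar visibility tree (UBVT) is a tree having a $1$-unit-bar visibility representation. A unit bar visibility forest is a graph every component of which is a UBVT. The unit bar visibility arboricity $\Upsilon_{ub}(G)$ is the minimum number of unit bar visibility forests into which the edge set of $G$ can be decomposed (i.e. edge-disjoint unit bar visibility forests whose union is $G$). *)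

theory Defs
  imports Complex_Main
begin

section \<open>Finite simple graphs\<close>

text \<open>A graph is given by its vertex set and its set of edges, the edges being two-element sets.\<close>

definition simple_graph :: "'a set \<Rightarrow> 'a set set \<Rightarrow> bool" where
  "simple_graph V E \<longleftrightarrow> finite V \<and> (\<forall>e\<in>E. \<exists>u\<in>V. \<exists>v\<in>V. u \<noteq> v \<and> e = {u, v})"

definition reachable_in :: "'a set set \<Rightarrow> 'a \<Rightarrow> 'a \<Rightarrow> bool" where
  "reachable_in E u v \<longleftrightarrow> (u, v) \<in> {(x, y). {x, y} \<in> E}\<^sup>*"

definition is_cycle :: "'a set set \<Rightarrow> 'a list \<Rightarrow> bool" where
  "is_cycle E xs \<longleftrightarrow> length xs \<ge> 3 \<and> distinct xs \<and>
     (\<forall>i<length xs. {xs ! i, xs ! (Suc i mod length xs)} \<in> E)"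

definition is_tree :: "'a set \<Rightarrow> 'a set set \<Rightarrow> bool" where
  "is_tree V E \<longleftrightarrow> simple_graph V E \<and> V \<noteq> {} \<and>
     (\<forall>u\<in>V. \<forall>v\<in>V. reachable_in E u v) \<and> (\<nexists>xs. is_cycle E xs)"

text \<open>The vertex sets of the connected components; the component on \<open>C\<close> is the subgraph
  induced by \<open>C\<close>.\<close>

definition component_sets :: "'a set \<Rightarrow> 'a set set \<Rightarrow> 'a set set" where
  "component_sets V E = (\<lambda>u. {v\<in>V. reachable_in E u v}) ` V"

definition induced_edges :: "'a set set \<Rightarrow> 'a set \<Rightarrow> 'a set set" where
  "induced_edges E C = {e\<in>E. e \<subseteq> C}"


section \<open>Unit bars and visibility\<close>

definition is_bar :: "(real \<times> real) set \<Rightarrow> bool" where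
  "is_bar B \<longleftrightarrow> (\<exists>x y. B = {x..x + 1} \<times> {y})"

definition sees_upward ::
  "(real \<times> real) set set \<Rightarrow> (real \<times> real) set \<Rightarrow> (real \<times> real) set \<Rightarrow> bool" where
  "sees_upward \<A> B C \<longleftrightarrow>
     (\<exists>a b c d. a < b \<and> c < d \<and> {a..b} \<times> {c} \<subseteq> B \<and> {a..b} \<times> {d} \<subseteq> C \<and>
        (\<forall>D\<in>\<A>. ({a<..<b} \<times> {c<..<d}) \<inter> D = {}))"

definition sees ::
  "(real \<times> real) set set \<Rightarrow> (real \<times> real) set \<Rightarrow> (real \<times> real) set \<Rightarrow> bool" where
  "sees \<A> B C \<longleftrightarrow> sees_upward \<A> B C \<or> sees_upward \<A> C B"

text \<open>The disjointness clause is indexed by pairs of a vertex and one of its bars, so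
  it also excludes that two vertices share a bar. A vertex may have no bar at all.\<close>

definition unit_bar_rep ::
  "nat \<Rightarrow> 'a set \<Rightarrow> 'a set set \<Rightarrow> ('a \<Rightarrow> (real \<times> real) set set) \<Rightarrow> bool" where
  "unit_bar_rep t V E \<phi> \<longleftrightarrow>
     (\<forall>v\<in>V. finite (\<phi> v) \<and> card (\<phi> v) \<le> t \<and> (\<forall>B\<in>\<phi> v. is_bar B)) \<and>
     (\<forall>u\<in>V. \<forall>v\<in>V. \<forall>B\<in>\<phi> u. \<forall>C\<in>\<phi> v. (u, B) \<noteq> (v, C) \<longrightarrow> B \<inter> C = {}) \<and>
     (\<forall>u\<in>V. \<forall>v\<in>V. u \<noteq> v \<longrightarrow>
        ({u, v} \<in> E \<longleftrightarrow> (\<exists>B\<in>\<phi> u. \<exists>C\<in>\<phi> v. sees (\<Union>w\<in>V. \<phi> w) B C)))"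

definition ub :: "'a set \<Rightarrow> 'a set set \<Rightarrow> nat" where
  "ub V E = (LEAST t. \<exists>\<phi>. unit_bar_rep t V E \<phi>)"


section \<open>Unit bar visibility arboricity\<close>

definition UBVT :: "'a set \<Rightarrow> 'a set set \<Rightarrow> bool" where
  "UBVT V E \<longleftrightarrow> is_tree V E \<and> (\<exists>\<phi>. unit_bar_rep 1 V E \<phi>)"

definition ub_forest :: "'a set \<Rightarrow> 'a set set \<Rightarrow> bool" where
  "ub_forest V E \<longleftrightarrow> simple_graph V E \<and>
     (\<forall>C\<in>component_sets V E. UBVT C (induced_edges E C))"

text \<open>The parts of a decomposition are taken as spanning subgraphs. This is no restriction,
  since an isolated vertex is a unit bar visibility tree. An edgeless graph has
  the decomposition into no forests.\<close>

definition ub_forest_decomposition :: "nat \<Rightarrow> 'a set \<Rightarrow> 'a set set \<Rightarrow> (nat \<Rightarrow> 'a set set) \<Rightarrow> bool" where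
  "ub_forest_decomposition k V E F \<longleftrightarrow>
     (\<Union>i<k. F i) = E \<and>
     (\<forall>i<k. \<forall>j<k. i \<noteq> j \<longrightarrow> F i \<inter> F j = {}) \<and>
     (\<forall>i<k. ub_forest V (F i))"

definition ub_arboricity :: "'a set \<Rightarrow> 'a set set \<Rightarrow> nat" where
  "ub_arboricity V E = (LEAST k. \<exists>F. ub_forest_decomposition k V E F)"

end

theory Submission
  imports Defs
begin

text \<open>
  A number \<open>t\<close> of bars per vertex suffices iff \<open>t\<close> forests suffice. Representations of the
  components of the forests can be placed side by side, which gives one direction.

  Conversely, sweep a vertical line over a representation of a tree \<open>T\<close> with \<open>t\<close> bars per vertex.
  Bars that are consecutive on the line see each other, so from bottom to top the line reads a
  lazy walk in \<open>T\<close>; hence the vertices on it induce a subtree. When an edge first appears, its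
  end away from the previous subtree has a bar starting there, and we charge the
  edge to that end; symmetrically when the edge last appears. Direct an edge towards an end that
  is charged twice, and call it undirected if both ends are charged once. Each vertex
  is charged at most \<open>2 * t\<close> times, and counting bars in windows of unit length shows
  that it is charged at most \<open>3 * t\<close> times if the outgoing edges are charged to it as well. Making
  superfluous outgoing edges undirected, we get at most \<open>t\<close> outgoing edges everywhere.

  Under these bounds the edges at a vertex can be coloured with \<open>t\<close> colours such that each colour
  has at most one outgoing edge, and besides it either one incoming or at most two undirected edges. As
  \<open>T\<close> is a tree, the local colourings fit together. A component of a colour class is then a
  subgraph of a comb: a path of undirected edges with a directed path hanging from each vertex.
  Unit bars at \<open>x = 3 * i / 5\<close>, with the teeth pointing down for even \<open>i\<close> and up for odd \<open>i\<close>, represent it.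
\<close>

section \<open>Trees\<close>

lemma reachable_refl [simp]: "reachable_in E u u"
  by (simp add: reachable_in_def)

lemma reachable_trans: "reachable_in E u v \<Longrightarrow> reachable_in E v w \<Longrightarrow> reachable_in E u w"
  unfolding reachable_in_def by (rule rtrancl_trans)

lemma reachable_edge: "{u, v} \<in> E \<Longrightarrow> reachable_in E u v"
  unfolding reachable_in_def by blast

lemma reachable_step: "reachable_in E u v \<Longrightarrow> {v, w} \<in> E \<Longrightarrow> reachable_in E u w"
  using reachable_trans reachable_edge by metis

lemma reachable_induct [consumes 1, case_names refl step]:
  assumes "reachable_in E u v" "P u"
    and "\<And>x y. reachable_in E u x \<Longrightarrow> {x, y} \<in> E \<Longrightarrow> P x \<Longrightarrow> P y"
  shows "P v"
  using assms(1) unfolding reachable_in_def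
  by (induction rule: rtrancl_induct) (use assms(2,3) in \<open>auto simp: reachable_in_def\<close>)

lemma reachable_sym: "reachable_in E u v \<Longrightarrow> reachable_in E v u"
proof (induction rule: reachable_induct)
  case (step x y)
  then have "{y, x} \<in> E" by (simp add: insert_commute)
  then show ?case using step reachable_trans reachable_edge by metis
qed simp

lemma reachable_mono: "reachable_in E u v \<Longrightarrow> E \<subseteq> F \<Longrightarrow> reachable_in F u v"
  by (induction rule: reachable_induct) (auto intro: reachable_step)

lemma reachable_closed:
  assumes "reachable_in E u v" "u \<in> S" "\<And>x y. x \<in> S \<Longrightarrow> {x, y} \<in> E \<Longrightarrow> y \<in> S"
  shows "v \<in> S"
  using assms by (induction rule: reachable_induct) auto

lemma reachable_leaves_set:
  assumes "reachable_in E u v" "u \<in> S" "v \<notin> S"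
  obtains x y where "x \<in> S" "y \<notin> S" "{x, y} \<in> E"
  using reachable_closed[OF assms(1,2)] assms(3) by blast

text \<open>If the next vertex of the walk already occurs on the path, the path is cut back to that
  occurrence. Reachability of its vertices is recorded so that a path in an induced subgraph can be
  seen to stay inside it.\<close>

lemma reachable_distinct_path:
  assumes "reachable_in E u v"
  shows "\<exists>xs. xs \<noteq> [] \<and> hd xs = u \<and> last xs = v \<and> distinct xs \<and>
    successively (\<lambda>x y. {x, y} \<in> E) xs \<and> (\<forall>x\<in>set xs. reachable_in E u x)"
  using assms
proof (induction rule: reachable_induct)
  case refl
  show ?case by (rule exI[of _ "[u]"]) simp
next
  case (step x y)
  then obtain xs where xs: "xs \<noteq> []" "hd xs = u" "last xs = x" "distinct xs"
    "successively (\<lambda>x y. {x, y} \<in> E) xs" "\<forall>x\<in>set xs. reachable_in E u x" by blast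
  show ?case
  proof (cases "y \<in> set xs")
    case True
    then obtain ys zs where "xs = ys @ y # zs" by (meson split_list)
    then have "xs = (ys @ [y]) @ zs" by simp
    with xs show ?thesis
      by (intro exI[of _ "ys @ [y]"]) (auto simp: successively_append_iff hd_append split: if_splits)
  next
    case False
    with xs step show ?thesis
      by (intro exI[of _ "xs @ [y]"])
        (auto simp: successively_append_iff intro: reachable_step)
  qed
qed

section \<open>Connected vertex sets and attachments to them\<close>

text \<open>The empty set counts as connected, since a cut of the sweep may be empty.\<close>

definition conn :: "'a set set \<Rightarrow> 'a set \<Rightarrow> bool" where
  "conn E S \<longleftrightarrow> (\<forall>u\<in>S. \<forall>v\<in>S. reachable_in (induced_edges E S) u v)"

lemma reachable_induced_mem:
  "reachable_in (induced_edges E S) u v \<Longrightarrow> u \<in> S \<Longrightarrow> v \<in> S"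
  by (erule reachable_closed) (auto simp: induced_edges_def)

lemma conn_singleton: "conn E {v}"
  by (simp add: conn_def)

lemma conn_insert:
  assumes "conn E S" "w \<in> S" "{v, w} \<in> E"
  shows "conn E (insert v S)"
proof -
  have sub: "reachable_in (induced_edges E (insert v S)) x y" if "x \<in> S" "y \<in> S" for x y
  proof (rule reachable_mono)
    show "reachable_in (induced_edges E S) x y" using assms(1) that unfolding conn_def by blast
  qed (auto simp: induced_edges_def)
  have vw: "reachable_in (induced_edges E (insert v S)) v w"
    using assms by (intro reachable_edge) (auto simp: induced_edges_def)
  have "reachable_in (induced_edges E (insert v S)) w x" if "x \<in> insert v S" for x
    using that sub[OF assms(2)] reachable_sym[OF vw] by auto
  then show ?thesis unfolding conn_def by (blast intro: reachable_trans[OF reachable_sym])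
qed

text \<open>A walk that witnesses membership visits only members. With \<open>T = - {v}\<close> and
  \<open>a\<close> other than \<open>v\<close>, the set is what \<open>a\<close> reaches without
  passing through \<open>v\<close>; with \<open>T = UNIV\<close> it is a component.\<close>

lemma conn_reachable_avoiding:
  "conn E {w. reachable_in (induced_edges E T) a w}" (is "conn E ?A")
proof -
  have "reachable_in (induced_edges E ?A) a w" if "reachable_in (induced_edges E T) a w" for w
    using that
  proof (induction rule: reachable_induct)
    case (step x y)
    then have "{x, y} \<in> induced_edges E ?A"
      using reachable_step[OF step(1,2)] by (auto simp: induced_edges_def)
    then show ?case using step by (auto intro: reachable_step)
  qed simp
  then show ?thesis unfolding conn_def by (blast intro: reachable_trans[OF reachable_sym])
qed

text \<open>Two edges from an outside vertex into a connected set would close a cycle.\<close>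

lemma unique_attachment:
  assumes "\<nexists>xs. is_cycle E xs" "conn E S" "v \<notin> S" "w \<in> S" "w' \<in> S" "{v, w} \<in> E" "{v, w'} \<in> E"
  shows "w = w'"
proof (rule ccontr)
  assume "w \<noteq> w'"
  have "reachable_in (induced_edges E S) w w'" using assms by (auto simp: conn_def)
  then obtain xs where xs: "xs \<noteq> []" "hd xs = w" "last xs = w'" "distinct xs"
      "successively (\<lambda>x y. {x, y} \<in> induced_edges E S) xs"
      and re: "\<forall>x\<in>set xs. reachable_in (induced_edges E S) w x"
    using reachable_distinct_path by metis
  have "set xs \<subseteq> S" using re reachable_induced_mem assms(4) by fast
  have "is_cycle E (v # xs)"
    unfolding is_cycle_def
  proof (intro conjI allI impI)
    show "3 \<le> length (v # xs)"
      using xs \<open>w \<noteq> w'\<close> by (cases xs; cases "tl xs") auto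
    show "distinct (v # xs)" using xs \<open>set xs \<subseteq> S\<close> assms by auto
    fix i assume "i < length (v # xs)"
    \<comment> \<open>Index \<open>0\<close> is the edge from \<open>v\<close> to \<open>w\<close>,
      the last index wraps around from \<open>w'\<close> to \<open>v\<close>, and the others are
      edges of the path.\<close>
    then consider "i = 0" | "i = length xs" "i > 0" | j where "i = Suc j" "Suc j < length xs"
      using xs(1) by (cases i) (auto simp: less_Suc_eq)
    then show "{(v # xs) ! i, (v # xs) ! (Suc i mod length (v # xs))} \<in> E"
    proof cases
      case 1
      then show ?thesis using xs assms(6) by (simp add: hd_conv_nth)
    next
      case 2
      then show ?thesis using xs assms(7)
        by (simp add: last_conv_nth nth_Cons' insert_commute)
    next
      case 3
      then have "{xs ! j, xs ! Suc j} \<in> induced_edges E S"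
        using xs(5) by (simp add: successively_conv_nth)
      then show ?thesis using 3 by (simp add: induced_edges_def)
    qed
  qed
  then show False using assms(1) by blast
qed

section \<open>Growing a tree vertex by vertex, and rooting it\<close>

lemma tree_edge:
  assumes "is_tree V E" "{u, v} \<in> E"
  shows "u \<in> V" "v \<in> V" "u \<noteq> v"
  using assms unfolding is_tree_def simple_graph_def by (auto simp: doubleton_eq_iff)

lemma tree_edge_obtain:
  assumes "is_tree V E" "e \<in> E"
  obtains u v where "e = {u, v}" "u \<noteq> v" "u \<in> V" "v \<in> V"
  using assms unfolding is_tree_def simple_graph_def by metis

text \<open>While \<open>S\<close> is not \<open>V\<close>, a walk from \<open>r\<close> to a
  missing vertex leaves \<open>S\<close> along some edge, and acyclicity makes it the only edge from
  the new vertex into \<open>S\<close>. So every tree arises by adding leaves.\<close>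

lemma tree_growth_induct [consumes 2, case_names root grow]:
  assumes tree: "is_tree V E" and "r \<in> V" and root: "P {r}"
    and grow: "\<And>S v w. S \<subseteq> V \<Longrightarrow> conn E S \<Longrightarrow> v \<in> V - S \<Longrightarrow> w \<in> S \<Longrightarrow> {v, w} \<in> E \<Longrightarrow>
      (\<And>w'. w' \<in> S \<Longrightarrow> {v, w'} \<in> E \<Longrightarrow> w' = w) \<Longrightarrow> P S \<Longrightarrow> P (insert v S)"
  shows "P V"
proof -
  have fin: "finite V" and ac: "\<nexists>xs. is_cycle E xs"
    using tree by (auto simp: is_tree_def simple_graph_def)
  have "n < card V \<Longrightarrow> \<exists>S\<subseteq>V. r \<in> S \<and> conn E S \<and> P S \<and> card S = Suc n" for n
  proof (induction n)
    case 0
    then show ?case using \<open>r \<in> V\<close> root conn_singleton by (intro exI[of _ "{r}"]) auto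
  next
    case (Suc n)
    then obtain S where S: "S \<subseteq> V" "r \<in> S" "conn E S" "P S" "card S = Suc n" by auto
    then obtain v0 where "v0 \<in> V" "v0 \<notin> S" using Suc.prems by (metis less_irrefl subset_antisym subsetI)
    then have "reachable_in E r v0" using tree \<open>r \<in> V\<close> by (auto simp: is_tree_def)
    then obtain w v where wv: "w \<in> S" "v \<notin> S" "{w, v} \<in> E"
      using reachable_leaves_set S \<open>v0 \<notin> S\<close> by metis
    then have vw: "{v, w} \<in> E" by (simp add: insert_commute)
    have "v \<in> V" using tree_edge[OF tree vw] by simp
    have "P (insert v S)"
      by (rule grow[of S v w]) (use S wv vw \<open>v \<in> V\<close> unique_attachment[OF ac S(3) wv(2)] in auto)
    then show ?case using S \<open>v \<in> V\<close> wv conn_insert[OF S(3) wv(1) vw] finite_subset[OF S(1) fin]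
      by (intro exI[of _ "insert v S"]) auto
  qed
  moreover have "card V > 0" using fin \<open>r \<in> V\<close> by (auto simp: card_gt_0_iff)
  ultimately obtain S where "S \<subseteq> V" "P S" "card S = Suc (card V - 1)"
    by (meson diff_less zero_less_one)
  then have "card S = card V" using \<open>card V > 0\<close> by simp
  then show ?thesis using card_subset_eq[OF fin \<open>S \<subseteq> V\<close>] \<open>P S\<close> by simp
qed

text \<open>This roots the tree at \<open>a\<close>: the parent \<open>p v\<close> is the neighbour
  of \<open>v\<close> in the part \<open>A v\<close> reachable from \<open>a\<close> without passing
  through \<open>v\<close>. A connected set containing the root is closed under parents.\<close>

lemma tree_parent:
  assumes tree: "is_tree V E" and "a \<in> V"
  shows "\<exists>p. (\<forall>u v. {u, v} \<in> E \<longrightarrow> (v \<noteq> a \<and> u = p v) \<or> (u \<noteq> a \<and> v = p u)) \<and>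
    (\<forall>S v. conn E S \<longrightarrow> a \<in> S \<longrightarrow> v \<in> S \<longrightarrow> v \<noteq> a \<longrightarrow> p v \<in> S)"
proof -
  have ac: "\<nexists>xs. is_cycle E xs" using tree by (auto simp: is_tree_def)
  define A where "A v = {w. reachable_in (induced_edges E (- {v})) a w}" for v
  define p where "p v = (SOME w. {v, w} \<in> E \<and> w \<in> A v)" for v
  have notA: "v \<notin> A v" if "v \<noteq> a" for v
    using reachable_induced_mem[of E "- {v}" a v] that by (auto simp: A_def)
  have pI: "w = p v" if "v \<noteq> a" "{v, w} \<in> E" "w \<in> A v" for v w
  proof -
    have "{v, p v} \<in> E \<and> p v \<in> A v"
      unfolding p_def by (rule someI[of _ w]) (use that in auto)
    then show ?thesis
      using unique_attachment[OF ac _ notA[OF that(1)]] conn_reachable_avoiding that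
      unfolding A_def by metis
  qed
  show ?thesis
  proof (intro exI[of _ p] conjI allI impI)
    fix u v assume uv: "{u, v} \<in> E"
    then have "u \<in> V" "u \<noteq> v" using tree_edge[OF tree] by auto
    consider "u = a" | "v = a" | "u \<noteq> a" "v \<noteq> a" by blast
    then show "(v \<noteq> a \<and> u = p v) \<or> (u \<noteq> a \<and> v = p u)"
    proof cases
      case 1
      then show ?thesis using pI[of v u] uv \<open>u \<noteq> v\<close> by (auto simp: A_def insert_commute)
    next
      case 2
      then show ?thesis using pI[of u v] uv \<open>u \<noteq> v\<close> by (auto simp: A_def)
    next
      case 3
      \<comment> \<open>Follow a walk from \<open>a\<close> until it first meets \<open>u\<close> or
        \<open>v\<close>: the end met first is reachable while avoiding the other.\<close>
      have "reachable_in E a z \<Longrightarrow> (z \<notin> {u, v} \<and> reachable_in (induced_edges E (- {u, v})) a z)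
          \<or> u \<in> A v \<or> v \<in> A u" for z
      proof (induction rule: reachable_induct)
        case refl
        then show ?case using 3 by simp
      next
        case (step x y)
        then consider "u \<in> A v \<or> v \<in> A u"
          | "x \<notin> {u, v}" "reachable_in (induced_edges E (- {u, v})) a x" by blast
        then show ?case
        proof cases
          case 2
          then have "x \<in> A v" "x \<in> A u"
            unfolding A_def by (auto elim!: reachable_mono simp: induced_edges_def)
          consider "y = u" | "y = v" | "y \<notin> {u, v}" by blast
          then show ?thesis
          proof cases
            case 1
            then have "{x, y} \<in> induced_edges E (- {v})"
              using 2 step \<open>u \<noteq> v\<close> by (auto simp: induced_edges_def)
            then show ?thesis using \<open>x \<in> A v\<close> 1 reachable_step unfolding A_def by fastforce
          next
            case y: 2
            then have "{x, y} \<in> induced_edges E (- {u})"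
              using 2 step \<open>u \<noteq> v\<close> by (auto simp: induced_edges_def)
            then show ?thesis using \<open>x \<in> A u\<close> y reachable_step unfolding A_def by fastforce
          next
            case 3
            then have "{x, y} \<in> induced_edges E (- {u, v})"
              using 2 step by (auto simp: induced_edges_def)
            then show ?thesis using 2 3 reachable_step by metis
          qed
        qed auto
      qed
      moreover have "reachable_in E a u"
        using tree \<open>a \<in> V\<close> \<open>u \<in> V\<close> by (auto simp: is_tree_def)
      ultimately have "u \<in> A v \<or> v \<in> A u" by blast
      then show ?thesis using pI uv 3 by (auto simp: insert_commute)
    qed
  next
    fix S v assume S: "conn E S" "a \<in> S" "v \<in> S" "v \<noteq> a"
    \<comment> \<open>Until it first meets \<open>v\<close>, a walk inside \<open>S\<close> stays in
      \<open>A v\<close>; the vertex from which it enters \<open>v\<close> is therefore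
      \<open>p v\<close>.\<close>
    have "reachable_in (induced_edges E S) a z \<Longrightarrow> (z \<noteq> v \<and> z \<in> A v) \<or> p v \<in> S" for z
    proof (induction rule: reachable_induct)
      case refl
      then show ?case using S by (simp add: A_def)
    next
      case (step x y)
      then consider "p v \<in> S" | "x \<noteq> v" "x \<in> A v" by blast
      then show ?case
      proof cases
        case 2
        show ?thesis
        proof (cases "y = v")
          case True
          then have "x = p v" using pI[of v x] 2 S step
            by (auto simp: induced_edges_def insert_commute)
          then show ?thesis using step by (auto simp: induced_edges_def)
        next
          case False
          then have "{x, y} \<in> induced_edges E (- {v})" using 2 step by (auto simp: induced_edges_def)
          then show ?thesis using 2 False reachable_step unfolding A_def by fastforce
        qed
      qed auto
    qed
    then show "p v \<in> S" using S by (auto simp: conn_def)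
  qed
qed

section \<open>Sweeping a family of unit intervals\<close>

text \<open>Here \<open>l v\<close> collects the left ends of the bars of \<open>v\<close>. The
  half-open conventions make \<open>rcut\<close> the vertices present at and just after
  \<open>x\<close>, and \<open>lcut\<close> those present at and just before
  \<open>x\<close>.\<close>

definition rcut :: "'a set \<Rightarrow> ('a \<Rightarrow> real set) \<Rightarrow> real \<Rightarrow> 'a set" where
  "rcut V l x = {v\<in>V. \<exists>b\<in>l v. b \<le> x \<and> x < b + 1}"

definition lcut :: "'a set \<Rightarrow> ('a \<Rightarrow> real set) \<Rightarrow> real \<Rightarrow> 'a set" where
  "lcut V l x = {v\<in>V. \<exists>b\<in>l v. b < x \<and> x \<le> b + 1}"

lemma finite_gap_right:
  fixes x :: real
  assumes "finite X"
  obtains x' where "x < x'" "\<And>b. b \<in> X \<Longrightarrow> x < b \<Longrightarrow> x' < b"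
proof -
  have "\<exists>x'>x. \<forall>b\<in>X. x < b \<longrightarrow> x' < b" using assms
  proof (induction X)
    case empty
    show ?case by (rule exI[of _ "x + 1"]) simp
  next
    case (insert c X)
    then obtain x' where x': "x < x'" "\<forall>b\<in>X. x < b \<longrightarrow> x' < b" by blast
    show ?case
    proof (cases "x < c")
      case True
      then obtain m where "x < m" "m < min c x'" using dense[of x "min c x'"] x' by auto
      then show ?thesis using x' by (intro exI[of _ m]) fastforce
    next
      case False
      then show ?thesis using x' by (intro exI[of _ x']) auto
    qed
  qed
  then show ?thesis using that by blast
qed

text \<open>With \<open>x'\<close> below the next start or end of an interval, the intervals alive
  just after \<open>x\<close> are those alive just before \<open>x'\<close>. This turns right cuts
  into left cuts.\<close>

lemma shift_right:
  fixes x :: real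
  assumes "finite X"
  obtains x' where "x < x'" "\<And>b. b \<in> X \<Longrightarrow> x < b \<Longrightarrow> x' < b"
    "\<And>b. b \<in> X \<Longrightarrow> (b \<le> x \<and> x < b + 1) \<longleftrightarrow> (b < x' \<and> x' \<le> b + 1)"
proof -
  obtain x' where x': "x < x'" "\<And>b. b \<in> X \<union> (\<lambda>b. b + 1) ` X \<Longrightarrow> x < b \<Longrightarrow> x' < b"
    using finite_gap_right[of "X \<union> (\<lambda>b. b + 1) ` X" x] assms by auto
  show ?thesis
  proof (rule that[OF x'(1)])
    fix b assume b: "b \<in> X"
    show "x < b \<Longrightarrow> x' < b" using x'(2) b by auto
    have "x < b \<Longrightarrow> x' < b" "x < b + 1 \<Longrightarrow> x' < b + 1" using x'(2) b by auto
    then show "(b \<le> x \<and> x < b + 1) \<longleftrightarrow> (b < x' \<and> x' \<le> b + 1)" using x'(1) by linarith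
  qed
qed

lemma shift_left:
  fixes x :: real
  assumes "finite X"
  obtains x' where "\<And>b. b \<in> X \<Longrightarrow> (b < x \<and> x \<le> b + 1) \<longleftrightarrow> (b \<le> x' \<and> x' < b + 1)"
proof -
  \<comment> \<open>The map from \<open>b\<close> to \<open>- b - 1\<close> gives the left end of
    the mirrored unit interval and interchanges the two half-open conventions.\<close>
  obtain x' where x': "\<And>b. b \<in> (\<lambda>b. - b - 1) ` X \<Longrightarrow>
      (b \<le> - x \<and> - x < b + 1) \<longleftrightarrow> (b < x' \<and> x' \<le> b + 1)"
    using shift_right[of "(\<lambda>b. - b - 1) ` X" "- x"] assms by (metis finite_imageI)
  show ?thesis
  proof (rule that[of "- x'"])
    fix b assume "b \<in> X"
    then have "(- b - 1 \<le> - x \<and> - x < - b - 1 + 1) \<longleftrightarrow> (- b - 1 < x' \<and> x' \<le> - b - 1 + 1)"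
      by (intro x') auto
    then show "(b < x \<and> x \<le> b + 1) \<longleftrightarrow> (b \<le> - x' \<and> - x' < b + 1)" by linarith
  qed
qed

lemma rcut_mirror: "rcut V (\<lambda>v. (\<lambda>b. - b - 1) ` l v) x = lcut V l (- x)"
proof -
  have "(- b - 1 \<le> x \<and> x < - b - 1 + 1) \<longleftrightarrow> (b < - x \<and> - x \<le> b + 1)" for b by auto
  then show ?thesis unfolding rcut_def lcut_def by simp
qed

lemma lcut_mirror: "lcut V (\<lambda>v. (\<lambda>b. - b - 1) ` l v) x = rcut V l (- x)"
proof -
  have "(- b - 1 < x \<and> x \<le> - b - 1 + 1) \<longleftrightarrow> (b \<le> - x \<and> - x < b + 1)" for b by auto
  then show ?thesis unfolding rcut_def lcut_def by simp
qed

section \<open>Charging edges on their first and last appearance\<close>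

text \<open>The later of the two starts is the first moment that both intervals cover. The
  alternative in the last assumption admits presence just before \<open>x\<close> as well as just
  after it.\<close>

lemma two_in_rcut:
  assumes "u \<in> V" "v \<in> V" "a \<in> l u" "b \<in> l v" "a \<le> x" "b \<le> x" "x \<le> a + 1" "x \<le> b + 1"
    "max a b < x \<or> x < a + 1 \<and> x < b + 1"
  shows "max a b \<in> l u \<union> l v" "{u, v} \<subseteq> rcut V l (max a b)"
proof -
  show "max a b \<in> l u \<union> l v" using assms by (auto simp: max_def)
  have "a \<le> max a b \<and> max a b < a + 1" "b \<le> max a b \<and> max a b < b + 1"
    using assms by auto
  then show "{u, v} \<subseteq> rcut V l (max a b)" using assms unfolding rcut_def by blast
qed

text \<open>\<open>fx e\<close> is the first moment at which both ends of \<open>e\<close> are present. Just before it the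
  (connected) cut lies on one side of \<open>e\<close>, and \<open>lc e\<close> is the end of \<open>e\<close> away from that side.\<close>

lemma first_appearance_charge:
  assumes tree: "is_tree V E"
    and fin: "\<And>v. v \<in> V \<Longrightarrow> finite (l v)"
    and cn: "\<And>x. conn E (lcut V l x)"
    and vis: "\<And>e. e \<in> E \<Longrightarrow> \<exists>x. e \<subseteq> rcut V l x"
  obtains lc fx where
    "\<forall>e\<in>E. lc e \<in> e \<and> e \<subseteq> rcut V l (fx e) \<and> lc e \<notin> lcut V l (fx e)"
    "inj_on (\<lambda>e. (lc e, fx e)) E"
proof -
  define X where "X = (\<Union>v\<in>V. l v)"
  have finX: "finite X" unfolding X_def
    using fin tree by (auto simp: is_tree_def simple_graph_def)
  \<comment> \<open>Two intervals begin to be present together at the left end of one of them, so a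
    minimum over the finite set \<open>X\<close> suffices.\<close>
  define fx where "fx e = Min {x\<in>X. e \<subseteq> rcut V l x}" for e
  have fx: "e \<subseteq> rcut V l (fx e)" "\<not> e \<subseteq> lcut V l (fx e)" if e: "e \<in> E" for e
  proof -
    obtain u v where uv: "e = {u, v}" "u \<in> V" "v \<in> V" using tree_edge_obtain[OF tree e] by metis
    obtain x where "e \<subseteq> rcut V l x" using vis e by blast
    then obtain a b where ab: "a \<in> l u" "b \<in> l v" "a \<le> x" "b \<le> x" "x < a + 1" "x < b + 1"
      unfolding rcut_def uv by auto
    have ne: "{x\<in>X. e \<subseteq> rcut V l x} \<noteq> {}"
      using two_in_rcut[of u V v a l b x] uv ab unfolding X_def by auto
    show "e \<subseteq> rcut V l (fx e)" using Min_in[OF _ ne] finX unfolding fx_def by auto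
    show "\<not> e \<subseteq> lcut V l (fx e)"
    proof
      assume "e \<subseteq> lcut V l (fx e)"
      then obtain a b where ab: "a \<in> l u" "b \<in> l v" "a < fx e" "b < fx e" "fx e \<le> a + 1" "fx e \<le> b + 1"
        unfolding lcut_def uv by auto
      then have "max a b \<in> {x\<in>X. e \<subseteq> rcut V l x}"
        using two_in_rcut[of u V v a l b "fx e"] uv unfolding X_def by auto
      then have "fx e \<le> max a b" unfolding fx_def using finX by (intro Min_le) auto
      then show False using ab by auto
    qed
  qed
  obtain r where "r \<in> V" using tree by (auto simp: is_tree_def)
  \<comment> \<open>At time \<open>x\<close> the tree is rooted in the left cut, or at the arbitrary
    vertex \<open>r\<close> if that is empty. The charged end \<open>lc e\<close> will be the child
    in \<open>e\<close> for the root at time \<open>fx e\<close>.\<close>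
  define a where "a x = (if lcut V l x = {} then r else SOME a. a \<in> lcut V l x)" for x
  have aS: "a x \<in> lcut V l x" if "lcut V l x \<noteq> {}" for x
    using that unfolding a_def by (auto intro: someI)
  have aV: "a x \<in> V" for x
    using aS[of x] \<open>r \<in> V\<close> by (cases "lcut V l x = {}") (auto simp: a_def lcut_def)
  have "\<forall>x. \<exists>p. (\<forall>u v. {u, v} \<in> E \<longrightarrow> (v \<noteq> a x \<and> u = p v) \<or> (u \<noteq> a x \<and> v = p u)) \<and>
      (\<forall>S v. conn E S \<longrightarrow> a x \<in> S \<longrightarrow> v \<in> S \<longrightarrow> v \<noteq> a x \<longrightarrow> p v \<in> S)"
    using tree_parent[OF tree aV] by blast
  from choice[OF this] obtain p where p:
    "\<And>x. (\<forall>u v. {u, v} \<in> E \<longrightarrow> (v \<noteq> a x \<and> u = p x v) \<or> (u \<noteq> a x \<and> v = p x u)) \<and>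
      (\<forall>S v. conn E S \<longrightarrow> a x \<in> S \<longrightarrow> v \<in> S \<longrightarrow> v \<noteq> a x \<longrightarrow> p x v \<in> S)"
    by blast
  have p1: "(v \<noteq> a x \<and> u = p x v) \<or> (u \<noteq> a x \<and> v = p x u)" if "{u, v} \<in> E" for x u v
    using p[of x] that by blast
  have p2: "p x v \<in> S" if "conn E S" "a x \<in> S" "v \<in> S" "v \<noteq> a x" for x S v
    using p[of x] that by blast
  have "\<exists>c. e = {c, p (fx e) c} \<and> c \<noteq> a (fx e)" if e: "e \<in> E" for e
  proof -
    obtain u v where "e = {u, v}" using tree_edge_obtain[OF tree e] by metis
    then show ?thesis using p1[of u v "fx e"] e by (metis insert_commute)
  qed
  then obtain lc where lc: "\<And>e. e \<in> E \<Longrightarrow> e = {lc e, p (fx e) (lc e)} \<and> lc e \<noteq> a (fx e)" by metis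
  show ?thesis
  proof (rule that[of lc fx]; (intro ballI inj_onI)?)
    fix e assume e: "e \<in> E"
    have "lc e \<in> e" using lc[OF e] by blast
    moreover have "lc e \<notin> lcut V l (fx e)"
    proof
      \<comment> \<open>A left cut containing the child is nonempty, hence contains the root and,
        being connected, the parent. Then both ends of \<open>e\<close> would be present just before
        \<open>fx e\<close>.\<close>
      assume c: "lc e \<in> lcut V l (fx e)"
      then have "p (fx e) (lc e) \<in> lcut V l (fx e)" using p2[OF cn] aS lc[OF e] by blast
      then have "{lc e, p (fx e) (lc e)} \<subseteq> lcut V l (fx e)" using c by simp
      then show False using fx(2)[OF e] lc[OF e] by auto
    qed
    ultimately show "lc e \<in> e \<and> e \<subseteq> rcut V l (fx e) \<and> lc e \<notin> lcut V l (fx e)"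
      using fx(1)[OF e] by blast
  next
    fix e e' assume "e \<in> E" "e' \<in> E" "(lc e, fx e) = (lc e', fx e')"
    \<comment> \<open>Equal times give the same root, and an edge is determined by its
      child.\<close>
    then show "e = e'" using lc by (metis prod.inject)
  qed
qed

text \<open>Reversing time turns last appearances into first ones and exchanges left and right
  cuts.\<close>

lemma last_appearance_charge:
  assumes tree: "is_tree V E"
    and fin: "\<And>v. v \<in> V \<Longrightarrow> finite (l v)"
    and cn: "\<And>x. conn E (rcut V l x)"
    and vis: "\<And>e. e \<in> E \<Longrightarrow> \<exists>x. e \<subseteq> lcut V l x"
  obtains rc lx where
    "\<forall>e\<in>E. rc e \<in> e \<and> e \<subseteq> lcut V l (lx e) \<and> rc e \<notin> rcut V l (lx e)"
    "inj_on (\<lambda>e. (rc e, lx e)) E"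
proof -
  let ?m = "\<lambda>v. (\<lambda>b. - b - 1) ` l v"
  have "finite (?m v)" if "v \<in> V" for v using fin[OF that] by simp
  moreover have "conn E (lcut V ?m x)" for x using cn unfolding lcut_mirror .
  moreover have "\<exists>x. e \<subseteq> rcut V ?m x" if "e \<in> E" for e
    using vis[OF that] unfolding rcut_mirror by (metis minus_minus)
  ultimately obtain lc fx where
    1: "\<forall>e\<in>E. lc e \<in> e \<and> e \<subseteq> rcut V ?m (fx e) \<and> lc e \<notin> lcut V ?m (fx e)" and
    2: "inj_on (\<lambda>e. (lc e, fx e)) E"
    by (rule first_appearance_charge[OF tree, where l = ?m])
  show ?thesis
  proof (rule that[of lc "\<lambda>e. - fx e"])
    show "\<forall>e\<in>E. lc e \<in> e \<and> e \<subseteq> lcut V l (- fx e) \<and> lc e \<notin> rcut V l (- fx e)"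
      using 1 unfolding rcut_mirror lcut_mirror .
  qed (use 2 in \<open>auto simp: inj_on_def\<close>)
qed

text \<open>Read \<open>A\<close> as the bars of one vertex \<open>v\<close>, \<open>U\<close> as neighbours of \<open>v\<close> for each of which a bar starts
  at time \<open>x u\<close> while \<open>v\<close> is present, and \<open>R\<close> as neighbours that are present when \<open>v\<close>
  disappears at time \<open>y w\<close>. Every maximal time interval in which \<open>v\<close> is present is tiled from
  the right by windows of length at most one; the items of a window are all present at its right end.\<close>

lemma window_count:
  fixes lft :: "'q \<Rightarrow> real" and x :: "'b \<Rightarrow> real" and y :: "'c \<Rightarrow> real"
  assumes finA: "finite A" and finU: "finite U" and finR: "finite R"
    and U1: "\<And>u. u \<in> U \<Longrightarrow> \<exists>q\<in>A. lft q \<le> x u \<and> x u < lft q + 1"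
    and R1: "\<And>w. w \<in> R \<Longrightarrow> \<exists>q\<in>A. lft q < y w \<and> y w \<le> lft q + 1"
    and R2: "\<And>w q. w \<in> R \<Longrightarrow> q \<in> A \<Longrightarrow> \<not> (lft q \<le> y w \<and> y w < lft q + 1)"
    and cnt: "\<And>z. card {u\<in>U. x u < z \<and> z \<le> x u + 1} + card {w\<in>R. y w = z}
      \<le> card {q\<in>A. lft q < z \<and> z \<le> lft q + 1} + 1"
  shows "card U + card R \<le> 2 * card A"
proof -
  \<comment> \<open>\<open>al z\<close> says that the vertex is present just before
    \<open>z\<close>. \<open>G z\<close> counts items up to \<open>z\<close>, departures at
    \<open>z\<close> itself included, and \<open>N z\<close> counts the bars started before
    \<open>z\<close>.\<close>
  define al where "al z \<longleftrightarrow> (\<exists>q\<in>A. lft q < z \<and> z \<le> lft q + 1)" for z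
  define G where "G z = card {u\<in>U. x u < z} + card {w\<in>R. y w \<le> z}" for z
  define N where "N z = card {q\<in>A. lft q < z}" for z
  have N_mono: "N z' \<le> N z" if "z' \<le> z" for z z'
    unfolding N_def using that finA by (intro card_mono) auto
  \<comment> \<open>No item occurs while the vertex is absent, so \<open>z\<close> can be moved back
    to the end \<open>z'\<close> of the last bar started before it.\<close>
  have skip: "\<exists>z'<z. al z' \<and> G z = G z'" if "\<not> al z" "G z > 0" for z
  proof -
    let ?B = "(\<lambda>q. lft q + 1) ` {q\<in>A. lft q < z}"
    have "{q\<in>A. lft q < z} \<noteq> {}"
    proof
      assume empty: "{q\<in>A. lft q < z} = {}"
      have "{u\<in>U. x u < z} = {}" using U1 empty by fastforce
      moreover have "{w\<in>R. y w \<le> z} = {}" using R1 empty by fastforce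
      ultimately show False using that(2) unfolding G_def by (metis add.right_neutral card.empty less_irrefl)
    qed
    then have ne: "?B \<noteq> {}" "finite ?B" using finA by auto
    define z' where "z' = Max ?B"
    have "z' \<in> ?B" unfolding z'_def using ne by (rule Max_in[rotated])
    then obtain q where q: "q \<in> A" "z' = lft q + 1" "lft q < z" by auto
    have le: "lft q \<le> z' - 1" if "q \<in> A" "lft q < z" for q
      using Max_ge[OF ne(2), of "lft q + 1"] that unfolding z'_def by auto
    have "z' < z" using q that(1) unfolding al_def by force
    moreover have "al z'" using q unfolding al_def by (intro bexI[of _ q]) auto
    moreover have "{u\<in>U. x u < z} = {u\<in>U. x u < z'}"
      using U1 le \<open>z' < z\<close> by fastforce
    moreover have "{w\<in>R. y w \<le> z} = {w\<in>R. y w \<le> z'}"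
      using R1 le \<open>z' < z\<close> by fastforce
    ultimately show ?thesis unfolding G_def by metis
  qed
  \<comment> \<open>Induction over the bars already started. Removing the window that ends at
    \<open>z\<close> removes \<open>card ?W\<close> bars and at most \<open>card ?W + 1\<close>
    items, which is at most \<open>2 * card ?W\<close>.\<close>
  have bound: "G z \<le> 2 * N z" if "al z" for z
    using that
  proof (induction "N z" arbitrary: z rule: less_induct)
    case less
    let ?D = "{b \<in> lft ` A. b < z \<and> \<not> al b}"
    \<comment> \<open>After a moment \<open>c\<close> of absence, the first bar start from
      \<open>c\<close> on is again a moment just before which the vertex is absent.\<close>
    have dead: "\<exists>b\<in>?D. c \<le> b" if "c < z" "\<not> al c" for c
    proof -
      let ?M = "{b \<in> lft ` A. c \<le> b \<and> b < z}"
      obtain q where q: "q \<in> A" "lft q < z" "z \<le> lft q + 1" using less.prems unfolding al_def by auto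
      then have "c \<le> lft q" using that unfolding al_def by force
      then have "?M \<noteq> {}" "finite ?M" using q finA by auto
      then have "Min ?M \<in> ?M" and Mle: "\<And>b. b \<in> ?M \<Longrightarrow> Min ?M \<le> b" using Min_in Min_le by blast+
      moreover have "\<not> al (Min ?M)"
      proof
        assume "al (Min ?M)"
        then obtain q where q: "q \<in> A" "lft q < Min ?M" "Min ?M \<le> lft q + 1" unfolding al_def by auto
        have "lft q < c" using Mle[of "lft q"] q \<open>Min ?M \<in> ?M\<close> by force
        then have "al c" using q \<open>Min ?M \<in> ?M\<close> unfolding al_def by force
        then show False using that by simp
      qed
      ultimately show ?thesis by auto
    qed
    \<comment> \<open>The window reaches from \<open>z0\<close> to \<open>z\<close>. If the vertex
      was absent during the last time unit, \<open>z0\<close> is the start of its current interval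
      of presence, otherwise \<open>z - 1\<close>; either way the bars covering \<open>z\<close>
      start no earlier than \<open>z0\<close>.\<close>
    obtain z0 where z0: "z - 1 \<le> z0" "z0 < z" "\<And>c. z0 < c \<Longrightarrow> c \<le> z \<Longrightarrow> al c"
      and lf: "\<And>q. q \<in> A \<Longrightarrow> lft q < z \<Longrightarrow> z \<le> lft q + 1 \<Longrightarrow> z0 \<le> lft q"
    proof (cases "\<exists>c. z - 1 \<le> c \<and> c < z \<and> \<not> al c")
      case True
      then obtain c where c: "z - 1 \<le> c" "c < z" "\<not> al c" by auto
      have finD: "finite ?D" and "?D \<noteq> {}" using finA dead[OF c(2,3)] by auto
      then have mem: "Max ?D \<in> ?D" by (rule Max_in)
      have ge: "c \<le> Max ?D" if "c < z" "\<not> al c" for c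
        using dead[OF that] Max_ge[OF finD] by force
      show ?thesis
      proof (rule that[of "Max ?D"])
        show "z - 1 \<le> Max ?D" using ge[OF c(2,3)] c by linarith
        show "Max ?D < z" using mem by auto
        show "al d" if "Max ?D < d" "d \<le> z" for d
          using ge[of d] that less.prems by (cases "d = z") auto
        show "Max ?D \<le> lft q" if q: "q \<in> A" "lft q < z" "z \<le> lft q + 1" for q
        proof (rule ccontr)
          assume "\<not> Max ?D \<le> lft q"
          then have "al (Max ?D)" using q mem unfolding al_def by force
          then show False using mem by auto
        qed
      qed
    next
      case False
      show ?thesis
      proof (rule that[of "z - 1"])
        show "al c" if "z - 1 < c" "c \<le> z" for c
          using False less.prems that by (cases "c = z") auto
      qed auto
    qed
    \<comment> \<open>A departure strictly inside the window would be followed by absence there. So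
      the departures of the window all happen at \<open>z\<close>.\<close>
    have Ry: "\<not> (z0 < y w \<and> y w < z)" if "w \<in> R" for w
    proof
      assume yw: "z0 < y w \<and> y w < z"
      obtain c where c: "y w < c" "\<And>b. b \<in> insert z (lft ` A) \<Longrightarrow> y w < b \<Longrightarrow> c < b"
        "\<And>b. b \<in> insert z (lft ` A) \<Longrightarrow> (b \<le> y w \<and> y w < b + 1) \<longleftrightarrow> (b < c \<and> c \<le> b + 1)"
        using shift_right[of "insert z (lft ` A)" "y w"] finA by (metis finite.insertI finite_imageI)
      have "al c" using z0(3)[of c] c(1) c(2)[of z] yw by auto
      then obtain q where "q \<in> A" "lft q < c \<and> c \<le> lft q + 1" unfolding al_def by auto
      then show False using c(3)[of "lft q"] R2[OF that] by blast
    qed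
    let ?W = "{q\<in>A. lft q < z \<and> z \<le> lft q + 1}"
    have Wpos: "card ?W \<ge> 1" using less.prems finA unfolding al_def
      by (auto simp: Suc_le_eq card_gt_0_iff)
    have "{q\<in>A. lft q < z0} \<inter> ?W = {}" using lf by force
    then have "N z0 + card ?W = card ({q\<in>A. lft q < z0} \<union> ?W)"
      unfolding N_def using finA by (subst card_Un_disjoint) auto
    also have "\<dots> \<le> N z" unfolding N_def using finA z0 by (intro card_mono) auto
    finally have NW: "N z0 + card ?W \<le> N z" .
    have "G z0 \<le> 2 * N z0"
    proof (cases "al z0 \<or> G z0 = 0")
      case True
      then show ?thesis using less.hyps[of z0] NW Wpos by auto
    next
      case False
      then obtain z' where z': "z' < z0" "al z'" "G z0 = G z'" using skip by blast
      have "N z' \<le> N z0" using z' by (intro N_mono) auto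
      moreover have "N z' < N z" using calculation NW Wpos by linarith
      ultimately show ?thesis using less.hyps[of z'] z' by auto
    qed
    moreover have "G z \<le> G z0 + (card ?W + 1)"
    proof -
      \<comment> \<open>A bar that starts between \<open>z0\<close> and \<open>z\<close> still
        reaches \<open>z\<close>, because \<open>z\<close> is at most \<open>z0 + 1\<close>.\<close>
      have "{u\<in>U. x u < z} \<subseteq> {u\<in>U. x u < z0} \<union> {u\<in>U. x u < z \<and> z \<le> x u + 1}"
        using z0 by force
      then have 1: "card {u\<in>U. x u < z} \<le> card {u\<in>U. x u < z0} + card {u\<in>U. x u < z \<and> z \<le> x u + 1}"
        using finU by (intro order.trans[OF card_mono card_Un_le]) auto
      have "{w\<in>R. y w \<le> z} \<subseteq> {w\<in>R. y w \<le> z0} \<union> {w\<in>R. y w = z}"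
        using Ry by force
      then have 2: "card {w\<in>R. y w \<le> z} \<le> card {w\<in>R. y w \<le> z0} + card {w\<in>R. y w = z}"
        using finR by (intro order.trans[OF card_mono card_Un_le]) auto
      show ?thesis using 1 2 cnt[of z] unfolding G_def by linarith
    qed
    ultimately show ?case using NW Wpos by linarith
  qed
  let ?Z = "insert 0 (x ` U \<union> y ` R \<union> (\<lambda>q. lft q + 1) ` A)"
  define m where "m = Max ?Z + 1"
  have le: "c < m" if "c \<in> x ` U \<union> y ` R \<union> (\<lambda>q. lft q + 1) ` A" for c
  proof -
    have "c \<le> Max ?Z" using that finA finU finR by (intro Max_ge) auto
    then show ?thesis unfolding m_def by linarith
  qed
  have "{u\<in>U. x u < m} = U" using le by blast
  moreover have "{w\<in>R. y w \<le> m} = R" using le less_imp_le by blast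
  ultimately have Gm: "G m = card U + card R" unfolding G_def by simp
  have "\<not> al m" using le unfolding al_def by (meson UnI2 imageI not_le)
  have NA: "N z \<le> card A" for z unfolding N_def using finA by (intro card_mono) auto
  show ?thesis
  proof (cases "G m = 0")
    case False
    then obtain z' where "al z'" "G m = G z'" using skip[OF \<open>\<not> al m\<close>] by blast
    then show ?thesis using bound[of z'] Gm NA[of z'] by linarith
  qed (use Gm in simp)
qed

text \<open>A pair \<open>(u, v) \<in> D\<close> is an edge directed from \<open>u\<close> to \<open>v\<close>; the remaining edges are undirected.
  The second bound says that there are at most \<open>2 * t\<close> undirected edges at \<open>v\<close> and edges
  into \<open>v\<close>, the latter counted twice.\<close>

definition balanced :: "nat \<Rightarrow> 'a set \<Rightarrow> 'a set set \<Rightarrow> ('a \<times> 'a) set \<Rightarrow> bool" where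
  "balanced t V E D \<longleftrightarrow>
     (\<forall>u v. (u, v) \<in> D \<longrightarrow> {u, v} \<in> E \<and> (v, u) \<notin> D) \<and>
     (\<forall>v\<in>V. card {u. (v, u) \<in> D} \<le> t \<and>
        card {u. {u, v} \<in> E \<and> (v, u) \<notin> D} + card {u. (u, v) \<in> D} \<le> 2 * t)"

section \<open>From a sweep to a balanced orientation\<close>

text \<open>The assumptions keep only what a sweep provides: cuts are connected, the ends of an edge
  share a cut, and in a cut \<open>v\<close> has at most one neighbour more than it has bars. A
  charge on first appearance uses up a bar start of \<open>v\<close>, one on last appearance a bar
  end, and \<open>window_count\<close> controls the edges charged elsewhere.\<close>

lemma sweep_balanced:
  fixes Q :: "'a \<Rightarrow> 'q set" and lft :: "'q \<Rightarrow> real"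
  defines "l \<equiv> \<lambda>v. lft ` Q v"
  assumes tree: "is_tree V E"
    and fin: "\<And>v. v \<in> V \<Longrightarrow> finite (Q v)" and le_t: "\<And>v. v \<in> V \<Longrightarrow> card (Q v) \<le> t"
    and cn: "\<And>x. conn E (rcut V l x)"
    and vis: "\<And>e. e \<in> E \<Longrightarrow> \<exists>x. e \<subseteq> rcut V l x"
    and nb: "\<And>v x. v \<in> V \<Longrightarrow> card {u \<in> rcut V l x. {u, v} \<in> E} \<le>
      card {q \<in> Q v. lft q \<le> x \<and> x < lft q + 1} + 1"
  shows "\<exists>D. balanced t V E D"
proof -
  have finV: "finite V" using tree by (auto simp: is_tree_def simple_graph_def)
  have finl: "finite (l v)" if "v \<in> V" for v using fin[OF that] by (simp add: l_def)
  define X where "X = (\<Union>v\<in>V. l v)"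
  have finX: "finite X" using finV finl by (simp add: X_def)
  \<comment> \<open>Cuts change at finitely many moments only, so a left cut is also the right cut
    at a slightly earlier moment, and the assumptions carry over.\<close>
  have lcut_eq: "\<exists>x'. lcut V l x = rcut V l x' \<and> (\<forall>v\<in>V.
      {q \<in> Q v. lft q < x \<and> x \<le> lft q + 1} = {q \<in> Q v. lft q \<le> x' \<and> x' < lft q + 1})" for x
  proof -
    obtain x' where "\<And>b. b \<in> X \<Longrightarrow> (b < x \<and> x \<le> b + 1) \<longleftrightarrow> (b \<le> x' \<and> x' < b + 1)"
      using shift_left[OF finX] by metis
    then show ?thesis unfolding lcut_def rcut_def X_def l_def by (intro exI[of _ x']) auto
  qed
  have rcut_eq: "\<exists>x'. rcut V l x = lcut V l x'" for x
  proof -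
    obtain x' where "\<And>b. b \<in> X \<Longrightarrow> (b \<le> x \<and> x < b + 1) \<longleftrightarrow> (b < x' \<and> x' \<le> b + 1)"
      using shift_right[OF finX] by metis
    then show ?thesis unfolding lcut_def rcut_def X_def by (intro exI[of _ x']) auto
  qed
  have cnl: "conn E (lcut V l x)" for x using lcut_eq[of x] cn by auto
  have visl: "\<exists>x. e \<subseteq> lcut V l x" if "e \<in> E" for e using vis[OF that] rcut_eq by metis
  have nbl: "card {u \<in> lcut V l x. {u, v} \<in> E} \<le> card {q \<in> Q v. lft q < x \<and> x \<le> lft q + 1} + 1"
    if "v \<in> V" for v x
  proof -
    obtain x' where "lcut V l x = rcut V l x'" and
      "{q \<in> Q v. lft q < x \<and> x \<le> lft q + 1} = {q \<in> Q v. lft q \<le> x' \<and> x' < lft q + 1}"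
      using lcut_eq[of x] \<open>v \<in> V\<close> by blast
    then show ?thesis using nb[OF \<open>v \<in> V\<close>, of x'] by simp
  qed
  obtain lc fx where lc: "\<forall>e\<in>E. lc e \<in> e \<and> e \<subseteq> rcut V l (fx e) \<and> lc e \<notin> lcut V l (fx e)"
    and lc_inj: "inj_on (\<lambda>e. (lc e, fx e)) E"
    using first_appearance_charge[of V E l] tree finl cnl vis by blast
  obtain rc lx where rc: "\<forall>e\<in>E. rc e \<in> e \<and> e \<subseteq> lcut V l (lx e) \<and> rc e \<notin> rcut V l (lx e)"
    and rc_inj: "inj_on (\<lambda>e. (rc e, lx e)) E"
    using last_appearance_charge[of V E l] tree finl cn visl by blast
  have lcD: "u \<in> rcut V l (fx {u, v})" "v \<in> rcut V l (fx {u, v})"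
      "lc {u, v} \<notin> lcut V l (fx {u, v})" "lc {u, v} = u \<or> lc {u, v} = v" if "{u, v} \<in> E" for u v
    using bspec[OF lc that] by auto
  have rcD: "u \<in> lcut V l (lx {u, v})" "v \<in> lcut V l (lx {u, v})"
      "rc {u, v} \<notin> rcut V l (lx {u, v})" "rc {u, v} = u \<or> rc {u, v} = v" if "{u, v} \<in> E" for u v
    using bspec[OF rc that] by auto
  define N where "N v = {u. {u, v} \<in> E}" for v
  \<comment> \<open>\<open>L v\<close> and \<open>R v\<close> belong to the edges charged to
    \<open>v\<close> on first and last appearance, and \<open>U v\<close> to those charged to the
    other end both times, the candidates for outgoing edges.\<close>
  define L where "L v = {u \<in> N v. lc {u, v} = v}" for v
  define R where "R v = {u \<in> N v. rc {u, v} = v}" for v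
  define U where "U v = {u \<in> N v. lc {u, v} \<noteq> v \<and> rc {u, v} \<noteq> v}" for v
  have NV: "N v \<subseteq> V" for v using tree_edge[OF tree] by (auto simp: N_def)
  have finN: "finite (N v)" for v using finite_subset[OF NV finV] .
  have finS: "finite (L v)" "finite (R v)" "finite (U v)" for v
    using finN by (auto simp: L_def R_def U_def)
  have other: "lc {u, v} = u" if "{u, v} \<in> E" "lc {u, v} \<noteq> v" for u v using lcD(4) that by blast
  have bar_start: "\<exists>q\<in>Q v. lft q = x" if "v \<in> rcut V l x" "v \<notin> lcut V l x" for v x
    using that unfolding rcut_def lcut_def l_def by force
  have bar_end: "\<exists>q\<in>Q v. lft q + 1 = x" if "v \<in> lcut V l x" "v \<notin> rcut V l x" for v x
    using that unfolding rcut_def lcut_def l_def by force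
  have inj_fx: "inj_on (\<lambda>u. fx {u, v}) (L v)" for v
  proof (rule inj_onI)
    fix u u' assume "u \<in> L v" "u' \<in> L v" "fx {u, v} = fx {u', v}"
    then have "{u, v} = {u', v}" using inj_onD[OF lc_inj] by (auto simp: L_def N_def)
    then show "u = u'" by (auto simp: doubleton_eq_iff)
  qed
  have inj_lx: "inj_on (\<lambda>u. lx {u, v}) (R v)" for v
  proof (rule inj_onI)
    fix u u' assume "u \<in> R v" "u' \<in> R v" "lx {u, v} = lx {u', v}"
    then have "{u, v} = {u', v}" using inj_onD[OF rc_inj] by (auto simp: R_def N_def)
    then show "u = u'" by (auto simp: doubleton_eq_iff)
  qed
  have Lt: "card (L v) \<le> t" if "v \<in> V" for v
  proof -
    have "(\<lambda>u. fx {u, v}) ` L v \<subseteq> lft ` Q v"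
    proof (rule image_subsetI)
      fix u assume "u \<in> L v"
      then have "{u, v} \<in> E" "lc {u, v} = v" by (auto simp: L_def N_def)
      then obtain q where "q \<in> Q v" "lft q = fx {u, v}"
        using bar_start[OF lcD(2), of u] lcD(3)[of u v] by auto
      then show "fx {u, v} \<in> lft ` Q v" by force
    qed
    then have "card (L v) \<le> card (Q v)"
      using card_inj_on_le[OF inj_fx] card_image_le[OF fin[OF that]] fin[OF that]
      by (meson finite_imageI order_trans)
    then show ?thesis using le_t[OF that] by linarith
  qed
  have URt: "card (U v) + card (R v) \<le> 2 * t" if v: "v \<in> V" for v
  proof -
    have "card (U v) + card (R v) \<le> 2 * card (Q v)"
    proof (rule window_count[where x = "\<lambda>u. fx {u, v}" and y = "\<lambda>u. lx {u, v}" and lft = lft])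
      show "\<exists>q\<in>Q v. lft q \<le> fx {u, v} \<and> fx {u, v} < lft q + 1" if "u \<in> U v" for u
      proof -
        have "v \<in> rcut V l (fx {u, v})" using that lcD(2) by (auto simp: U_def N_def)
        then show ?thesis by (auto simp: rcut_def l_def)
      qed
      show "\<exists>q\<in>Q v. lft q < lx {w, v} \<and> lx {w, v} \<le> lft q + 1" if "w \<in> R v" for w
      proof -
        have "v \<in> lcut V l (lx {w, v})" using that rcD(2) by (auto simp: R_def N_def)
        then show ?thesis by (auto simp: lcut_def l_def)
      qed
      show "\<not> (lft q \<le> lx {w, v} \<and> lx {w, v} < lft q + 1)" if "w \<in> R v" "q \<in> Q v" for w q
      proof -
        have "v \<notin> rcut V l (lx {w, v})" using that rcD(3)[of w v] by (auto simp: R_def N_def)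
        then show ?thesis using that v by (auto simp: rcut_def l_def)
      qed
      fix z
      let ?A = "{u \<in> U v. fx {u, v} < z \<and> z \<le> fx {u, v} + 1}" and ?B = "{w \<in> R v. lx {w, v} = z}"
      have "?A \<inter> ?B = {}" by (auto simp: U_def R_def)
      then have "card ?A + card ?B = card (?A \<union> ?B)"
        using finS by (intro card_Un_disjoint[symmetric]) auto
      also have "\<dots> \<le> card {u \<in> lcut V l z. {u, v} \<in> E}"
      proof (rule card_mono)
        show "finite {u \<in> lcut V l z. {u, v} \<in> E}" using finV by (simp add: lcut_def)
        \<comment> \<open>As \<open>u\<close> is the charged end, one of its own bars starts at
          \<open>fx {u, v}\<close>, and this bar still covers \<open>z\<close>.\<close>
        have "u \<in> lcut V l z" if "u \<in> ?A" for u
        proof -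
          have e: "{u, v} \<in> E" "lc {u, v} = u" using that other by (auto simp: U_def N_def)
          then obtain q where "q \<in> Q u" "lft q = fx {u, v}" using bar_start[OF lcD(1)] lcD(3)[of u v] by auto
          moreover have "u \<in> V" using tree_edge[OF tree e(1)] by simp
          ultimately show ?thesis using that unfolding lcut_def l_def by force
        qed
        moreover have "u \<in> lcut V l z" if "u \<in> ?B" for u
          using that rcD(1) by (auto simp: R_def N_def)
        ultimately show "?A \<union> ?B \<subseteq> {u \<in> lcut V l z. {u, v} \<in> E}"
          by (auto simp: U_def R_def N_def)
      qed
      also have "\<dots> \<le> card {q \<in> Q v. lft q < z \<and> z \<le> lft q + 1} + 1" by (rule nbl[OF v])
      finally show "card ?A + card ?B \<le> card {q \<in> Q v. lft q < z \<and> z \<le> lft q + 1} + 1" .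
    qed (use finS fin[OF v] in auto)
    then show ?thesis using le_t[OF v] by linarith
  qed
  have Rt: "card (R v) \<le> t" if "v \<in> V" for v
  proof -
    have "(\<lambda>u. lx {u, v}) ` R v \<subseteq> (\<lambda>q. lft q + 1) ` Q v"
    proof (rule image_subsetI)
      fix u assume "u \<in> R v"
      then have "{u, v} \<in> E" "rc {u, v} = v" by (auto simp: R_def N_def)
      then obtain q where "q \<in> Q v" "lft q + 1 = lx {u, v}"
        using bar_end[OF rcD(2), of u] rcD(3)[of u v] by auto
      then show "lx {u, v} \<in> (\<lambda>q. lft q + 1) ` Q v" by force
    qed
    then have "card (R v) \<le> card (Q v)"
      using card_inj_on_le[OF inj_lx] card_image_le[OF fin[OF that]] fin[OF that]
      by (meson finite_imageI order_trans)
    then show ?thesis using le_t[OF that] by linarith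
  qed
  \<comment> \<open>At most \<open>t\<close> candidates stay directed; any surplus becomes
    undirected.\<close>
  have "\<exists>T. T \<subseteq> U v \<and> card T = min (card (U v)) t" for v
    using obtain_subset_with_card_n[of "min (card (U v)) t" "U v"] by (metis min.cobounded1)
  then obtain T where T: "\<And>v. T v \<subseteq> U v" "\<And>v. card (T v) = min (card (U v)) t" by metis
  define D where "D = {(v, u). u \<in> T v}"
  have "balanced t V E D" unfolding balanced_def
  proof (intro conjI allI ballI impI)
    fix u v assume "(u, v) \<in> D"
    then have "v \<in> U u" using T by (auto simp: D_def)
    then have e: "{u, v} \<in> E" "lc {u, v} = v" using other[of v u]
      by (auto simp: U_def N_def insert_commute)
    then show "{u, v} \<in> E" by simp
    show "(v, u) \<notin> D" using T(1)[of v] e by (auto simp: D_def U_def)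
  next
    fix v assume v: "v \<in> V"
    have out: "{u. (v, u) \<in> D} = T v" by (auto simp: D_def)
    then show "card {u. (v, u) \<in> D} \<le> t" using T by simp
    have "{u. (u, v) \<in> D} \<subseteq> L v \<inter> R v"
    proof
      fix u assume "u \<in> {u. (u, v) \<in> D}"
      then have "v \<in> U u" using T by (auto simp: D_def)
      then have "{u, v} \<in> E" "lc {v, u} \<noteq> u" "rc {v, u} \<noteq> u"
        by (auto simp: U_def N_def insert_commute)
      moreover have "lc {u, v} = u \<or> lc {u, v} = v" "rc {u, v} = u \<or> rc {u, v} = v"
        using lcD(4) rcD(4) calculation(1) by blast+
      ultimately show "u \<in> L v \<inter> R v" by (auto simp: L_def R_def N_def insert_commute)
    qed
    then have 1: "card {u. (u, v) \<in> D} \<le> card (L v \<inter> R v)" using finS by (intro card_mono) auto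
    have "{u. {u, v} \<in> E \<and> (v, u) \<notin> D} = N v - T v" by (auto simp: N_def D_def)
    moreover have "T v \<subseteq> N v" using T(1)[of v] by (auto simp: U_def)
    ultimately have 2: "card {u. {u, v} \<in> E \<and> (v, u) \<notin> D} + card (T v) = card (N v)"
      using finN card_mono[OF finN] finite_subset[OF _ finN] by (simp add: card_Diff_subset)
    have "N v \<subseteq> (L v \<union> R v) \<union> U v" by (auto simp: L_def R_def U_def)
    then have 3: "card (N v) \<le> card (L v \<union> R v) + card (U v)"
      using finS by (intro order.trans[OF card_mono card_Un_le]) auto
    have 4: "card (L v \<union> R v) + card (L v \<inter> R v) = card (L v) + card (R v)"
      using finS card_Un_Int by metis
    \<comment> \<open>With L, R, U for the cardinalities, the sum is at most L + R + U - min(U, t).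
      If U is at most \<open>t\<close>, use the bounds on L and R; otherwise those on L and on U +
      R.\<close>
    show "card {u. {u, v} \<in> E \<and> (v, u) \<notin> D} + card {u. (u, v) \<in> D} \<le> 2 * t"
      using 1 2 3 4 T(2)[of v] Lt[OF v] Rt[OF v] URt[OF v] by linarith
  qed
  then show ?thesis by blast
qed

section \<open>Colouring the edges\<close>

text \<open>\<open>f u\<close> is the colour of the edge from a fixed vertex to its neighbour
  \<open>u\<close>. Outgoing edges are not compared with the others, because a vertex of a comb may
  have an edge down its tooth besides its edge from above or its spine edges.\<close>

definition local_colouring :: "nat \<Rightarrow> 'a set \<Rightarrow> 'a set \<Rightarrow> 'a set \<Rightarrow> ('a \<Rightarrow> nat) \<Rightarrow> bool" where
  "local_colouring t In Out P f \<longleftrightarrow> (\<forall>u\<in>In \<union> Out \<union> P. f u < t) \<and> inj_on f Out \<and> inj_on f In \<and>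
     (\<forall>u\<in>In. \<forall>w\<in>P. f u \<noteq> f w) \<and> (\<forall>c. card {w\<in>P. f w = c} \<le> 2)"

lemma local_colouring_cong:
  assumes "\<And>u. u \<in> In \<union> Out \<union> P \<Longrightarrow> f u = g u"
  shows "local_colouring t In Out P f \<longleftrightarrow> local_colouring t In Out P g"
proof -
  have "{w\<in>P. f w = c} = {w\<in>P. g w = c}" for c using assms by auto
  moreover have "inj_on f Out = inj_on g Out" "inj_on f In = inj_on g In"
    using assms by (auto intro!: inj_on_cong)
  ultimately show ?thesis unfolding local_colouring_def using assms by auto
qed

text \<open>Incoming edges get the first \<open>card In\<close> colours, one each; the undirected
  edges follow, two to a colour, by halving their numbers. Outgoing edges are numbered from
  \<open>0\<close> independently.\<close>

lemma local_colouring_exists: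
  assumes fin: "finite In" "finite Out" "finite P"
    and disj: "In \<inter> P = {}" "Out \<inter> (In \<union> P) = {}"
    and out: "card Out \<le> t" and inp: "2 * card In + card P \<le> 2 * t"
  shows "\<exists>f. local_colouring t In Out P f"
proof -
  obtain hI where hI: "bij_betw hI In {0..<card In}" using ex_bij_betw_finite_nat[OF fin(1)] by blast
  obtain hO where hO: "bij_betw hO Out {0..<card Out}" using ex_bij_betw_finite_nat[OF fin(2)] by blast
  obtain hP where hP: "bij_betw hP P {0..<card P}" using ex_bij_betw_finite_nat[OF fin(3)] by blast
  define f where "f u = (if u \<in> Out then hO u else if u \<in> In then hI u else card In + hP u div 2)" for u
  have fO: "f u = hO u \<and> hO u < card Out" if "u \<in> Out" for u
    using bij_betwE[OF hO] that by (auto simp: f_def)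
  have fI: "f u = hI u \<and> hI u < card In" if "u \<in> In" for u
    using bij_betwE[OF hI] that disj by (auto simp: f_def)
  have fP: "f u = card In + hP u div 2 \<and> hP u < card P" if "u \<in> P" for u
    using bij_betwE[OF hP] that disj by (auto simp: f_def)
  have "local_colouring t In Out P f" unfolding local_colouring_def
  proof (intro conjI ballI allI)
    fix u assume "u \<in> In \<union> Out \<union> P"
    then consider "u \<in> In" | "u \<in> Out" | "u \<in> P" by blast
    then show "f u < t" using fO[of u] fI[of u] fP[of u] out inp by cases linarith+
  next
    show "inj_on f Out" using hO fO by (metis (no_types, lifting) bij_betw_def inj_on_cong)
    show "inj_on f In" using hI fI by (metis (no_types, lifting) bij_betw_def inj_on_cong)
  next
    fix u w assume "u \<in> In" "w \<in> P"
    then show "f u \<noteq> f w" using fI[of u] fP[of w] by linarith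
  next
    fix c
    have "hP ` {w\<in>P. f w = c} \<subseteq> {2 * (c - card In), 2 * (c - card In) + 1}"
    proof
      fix k assume "k \<in> hP ` {w\<in>P. f w = c}"
      then obtain w where "w \<in> P" "f w = c" "k = hP w" by auto
      then have "k div 2 = c - card In" using fP[of w] by auto
      then show "k \<in> {2 * (c - card In), 2 * (c - card In) + 1}" by auto
    qed
    then have "card (hP ` {w\<in>P. f w = c}) \<le> card {2 * (c - card In), 2 * (c - card In) + 1}"
      by (intro card_mono) auto
    moreover have "inj_on hP {w\<in>P. f w = c}"
      using hP by (auto simp: bij_betw_def inj_on_def)
    ultimately show "card {w\<in>P. f w = c} \<le> 2" by (simp add: card_image)
  qed
  then show ?thesis by blast
qed

text \<open>The conditions are invariant under permuting the colours below \<open>t\<close>;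
  \<open>s\<close> exchanges \<open>f u0\<close> and \<open>c0\<close>.\<close>

lemma local_colouring_prescribed:
  assumes "local_colouring t In Out P f" "u0 \<in> In \<union> Out \<union> P" "c0 < t"
  shows "\<exists>f. local_colouring t In Out P f \<and> f u0 = c0"
proof -
  define s where "s c = (if c = f u0 then c0 else if c = c0 then f u0 else c)" for c
  have ss: "s (s c) = c" for c by (auto simp: s_def)
  have inj: "inj s" using ss by (metis injI)
  have lt: "s c < t" if "c < t" for c
    using that assms unfolding s_def local_colouring_def by auto
  have "{w\<in>P. s (f w) = c} = {w\<in>P. f w = s c}" for c using ss by auto
  moreover have "inj_on (\<lambda>u. s (f u)) X" if "inj_on f X" for X
    using that inj by (auto simp: inj_on_def)
  ultimately have "local_colouring t In Out P (\<lambda>u. s (f u))"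
    using assms(1) lt inj unfolding local_colouring_def by (auto simp: inj_eq)
  moreover have "s (f u0) = c0" by (simp add: s_def)
  ultimately show ?thesis by blast
qed

abbreviation undirected_nbrs :: "'a set set \<Rightarrow> ('a \<times> 'a) set \<Rightarrow> 'a \<Rightarrow> 'a set" where
  "undirected_nbrs E D v \<equiv> {u. {u, v} \<in> E \<and> (u, v) \<notin> D \<and> (v, u) \<notin> D}"

section \<open>Fitting the local colourings together along the tree\<close>

text \<open>When the tree is grown, a new vertex meets the earlier ones in a single edge, so its
  local colouring has to match only one colour already given.\<close>

lemma balanced_colouring:
  assumes tree: "is_tree V E" and bal: "balanced t V E D"
  shows "\<exists>\<kappa>. \<forall>v\<in>V. local_colouring t {u. (u, v) \<in> D} {u. (v, u) \<in> D} (undirected_nbrs E D v)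
    (\<lambda>u. \<kappa> {u, v})"
proof -
  define In where "In v = {u. (u, v) \<in> D}" for v
  define Out where "Out v = {u. (v, u) \<in> D}" for v
  define P where "P v = undirected_nbrs E D v" for v
  have D: "{u, v} \<in> E" "(v, u) \<notin> D" if "(u, v) \<in> D" for u v
    using bal that by (auto simp: balanced_def)
  have N: "In v \<union> Out v \<union> P v = {u. {u, v} \<in> E}" for v
    using D(1)[of _ v] D(1)[of v, unfolded insert_commute[of v]] by (auto simp: In_def Out_def P_def)
  have finV: "finite V" using tree by (auto simp: is_tree_def simple_graph_def)
  have fin: "finite (In v \<union> Out v \<union> P v)" for v
    unfolding N using tree_edge[OF tree] by (intro finite_subset[OF _ finV]) auto
  have loc: "\<exists>f. local_colouring t (In v) (Out v) (P v) f" if "v \<in> V" for v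
  proof (rule local_colouring_exists)
    show disj: "In v \<inter> P v = {}" "Out v \<inter> (In v \<union> P v) = {}"
      using D by (auto simp: In_def Out_def P_def)
    show "card (Out v) \<le> t" using bal that by (auto simp: balanced_def Out_def)
    have "{u. {u, v} \<in> E \<and> (v, u) \<notin> D} = In v \<union> P v"
      using D by (auto simp: In_def P_def)
    moreover have "card (In v \<union> P v) = card (In v) + card (P v)"
      using fin[of v] disj by (intro card_Un_disjoint) auto
    moreover have "card {u. {u, v} \<in> E \<and> (v, u) \<notin> D} + card (In v) \<le> 2 * t"
      using bal that by (auto simp: balanced_def In_def)
    ultimately show "2 * card (In v) + card (P v) \<le> 2 * t" by simp
  qed (use fin[of v] in auto)
  obtain r where "r \<in> V" using tree by (auto simp: is_tree_def)
  \<comment> \<open>The choice recovers the other end of an edge at \<open>v\<close>, which turns a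
    colouring of neighbours into one of edges.\<close>
  have other: "(SOME u. {x, v} = {u, v}) = x" for x v :: 'a
    by (rule some_equality) (auto simp: doubleton_eq_iff)
  from tree \<open>r \<in> V\<close>
  have "\<exists>\<kappa>. \<forall>v\<in>V. local_colouring t (In v) (Out v) (P v) (\<lambda>u. \<kappa> {u, v})"
  proof (induction rule: tree_growth_induct)
    case root
    obtain f where "local_colouring t (In r) (Out r) (P r) f" using loc[OF \<open>r \<in> V\<close>] by blast
    then show ?case by (intro exI[of _ "\<lambda>e. f (SOME u. e = {u, r})"]) (simp add: other)
  next
    case (grow S v w)
    then obtain \<kappa> where \<kappa>: "\<forall>v\<in>S. local_colouring t (In v) (Out v) (P v) (\<lambda>u. \<kappa> {u, v})" by blast
    have wN: "w \<in> In v \<union> Out v \<union> P v" "v \<in> In w \<union> Out w \<union> P w"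
      unfolding N using grow(5) by (simp_all add: insert_commute)
    have "\<kappa> {v, w} < t"
      using bspec[OF \<kappa> grow(4)] wN(2) unfolding local_colouring_def by blast
    moreover obtain f0 where "local_colouring t (In v) (Out v) (P v) f0" using loc[of v] grow(3) by blast
    ultimately obtain f where f: "local_colouring t (In v) (Out v) (P v) f" "f w = \<kappa> {v, w}"
      using local_colouring_prescribed[OF _ wN(1)] by blast
    define \<kappa>' where "\<kappa>' e = (if v \<in> e then f (SOME u. e = {u, v}) else \<kappa> e)" for e
    have "local_colouring t (In x) (Out x) (P x) (\<lambda>u. \<kappa>' {u, x})" if "x \<in> insert v S" for x
    proof (cases "x = v")
      case True
      then show ?thesis using f by (simp add: \<kappa>'_def other)
    next
      case False
      then have x: "x \<in> S" using that by simp
      have "\<kappa> {u, x} = \<kappa>' {u, x}" if u: "u \<in> In x \<union> Out x \<union> P x" for u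
      proof (cases "u = v")
        case True
        then have "{v, x} \<in> E" using u unfolding N by simp
        then have "x = w" using grow(6) x by blast
        then have "\<kappa>' {u, x} = f w"
          using True other[of w v] by (simp add: \<kappa>'_def insert_commute)
        then show ?thesis using f True \<open>x = w\<close> by simp
      qed (use False in \<open>simp add: \<kappa>'_def\<close>)
      then show ?thesis using \<kappa> x local_colouring_cong by (metis (no_types, lifting))
    qed
    then show ?case by blast
  qed
  then show ?thesis by (simp add: In_def Out_def P_def)
qed


section \<open>Combs\<close>

text \<open>Row \<open>0\<close> is the spine of the comb, and the tooth at \<open>i\<close> consists of the points \<open>(i, d)\<close>.\<close>

definition comb_adj :: "int \<times> nat \<Rightarrow> int \<times> nat \<Rightarrow> bool" where
  "comb_adj p q \<longleftrightarrow> fst p = fst q \<and> (snd q = Suc (snd p) \<or> snd p = Suc (snd q)) \<or>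
     snd p = 0 \<and> snd q = 0 \<and> (fst q = fst p + 1 \<or> fst p = fst q + 1)"

text \<open>Only edges inside \<open>S\<close> are tested, so partially grown trees qualify. Closure
  towards the spine matters for the drawing: a gap in a tooth would let bars see each other across
  it.\<close>

definition comb_embedding :: "'a set \<Rightarrow> 'a set set \<Rightarrow> ('a \<Rightarrow> int \<times> nat) \<Rightarrow> bool" where
  "comb_embedding S F \<pi> \<longleftrightarrow> inj_on \<pi> S \<and> (\<forall>i d. (i, Suc d) \<in> \<pi> ` S \<longrightarrow> (i, d) \<in> \<pi> ` S) \<and>
     (\<forall>u\<in>S. \<forall>v\<in>S. {u, v} \<in> F \<longleftrightarrow> comb_adj (\<pi> u) (\<pi> v))"

lemma comb_adj_commute: "comb_adj p q \<longleftrightarrow> comb_adj q p"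
  by (auto simp: comb_adj_def)

lemma not_comb_adj_self [simp]: "\<not> comb_adj p p"
  by (auto simp: comb_adj_def)

lemma comb_embedding_root:
  assumes "comb_embedding S F \<pi>" "(i, d) \<in> \<pi> ` S"
  shows "(i, 0) \<in> \<pi> ` S"
  using assms(2) by (induction d) (use assms(1) in \<open>auto simp: comb_embedding_def\<close>)

section \<open>Embedding oriented trees into the comb\<close>

text \<open>A new leaf \<open>v\<close> either leaves the old source \<open>r\<close> a source or
  has its only edge directed into \<open>r\<close>; in that case \<open>v\<close> itself is a
  source.\<close>

lemma directed_tree_source:
  assumes tree: "is_tree C F" and anti: "\<And>u v. (u, v) \<in> D \<Longrightarrow> {u, v} \<in> F \<and> (v, u) \<notin> D"
  shows "\<exists>r\<in>C. \<forall>u\<in>C. (u, r) \<notin> D"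
proof -
  obtain a where "a \<in> C" using tree by (auto simp: is_tree_def)
  from tree this show ?thesis
  proof (induction rule: tree_growth_induct)
    case root
    show ?case using anti[of a a] by auto
  next
    case (grow S v w)
    then obtain r where r: "r \<in> S" "\<forall>u\<in>S. (u, r) \<notin> D" by blast
    show ?case
    proof (cases "(v, r) \<in> D")
      case True
      then have "r = w" using anti[of v r] r grow by blast
      have "(u, v) \<notin> D" if "u \<in> insert v S" for u
      proof
        assume uv: "(u, v) \<in> D"
        then have "{v, u} \<in> F" "u \<noteq> v" using anti[of u v] by (auto simp: insert_commute)
        then have "u = w" using that grow by blast
        then show False using anti[OF True] uv \<open>r = w\<close> by blast
      qed
      then show ?thesis by blast
    next
      case False
      then show ?thesis using r by blast
    qed
  qed
qed

text \<open>Directed edges lead down the teeth and undirected edges form the spine. Growing the tree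
  from a source, no edge is ever met against its direction.\<close>

lemma comb_embedding_exists:
  assumes tree: "is_tree C F"
    and D: "\<And>u v. (u, v) \<in> D \<Longrightarrow> {u, v} \<in> F \<and> (v, u) \<notin> D"
    and out1: "\<And>u v w. (v, u) \<in> D \<Longrightarrow> (v, w) \<in> D \<Longrightarrow> u = w"
    and in1: "\<And>u v w. (u, v) \<in> D \<Longrightarrow> (w, v) \<in> D \<Longrightarrow> u = w"
    and excl: "\<And>u v w. (u, v) \<in> D \<Longrightarrow> w \<notin> undirected_nbrs F D v"
    and two: "\<And>v. v \<in> C \<Longrightarrow> card (undirected_nbrs F D v) \<le> 2"
  shows "\<exists>\<pi>. comb_embedding C F \<pi>"
proof -
  define P where "P v = undirected_nbrs F D v" for v
  have finC: "finite C" using tree by (auto simp: is_tree_def simple_graph_def)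
  have finP: "finite (P v)" for v
    using tree_edge[OF tree] by (intro finite_subset[OF _ finC]) (auto simp: P_def)
  have no_loop: "{v} \<notin> F" for v using tree_edge[OF tree, of v v] by auto
  \<comment> \<open>Besides the position of each kind of edge, the invariant records that the
    occupied columns form an interval, which provides free room at its ends, and that
    \<open>S\<close> contains all \<open>D\<close>-predecessors of its members, so that no new edge
    points into \<open>S\<close>.\<close>
  define inv where "inv S \<pi> \<longleftrightarrow> comb_embedding S F \<pi> \<and>
      (\<forall>u\<in>S. \<forall>v\<in>S. (u, v) \<in> D \<longrightarrow> fst (\<pi> u) = fst (\<pi> v) \<and> snd (\<pi> v) = Suc (snd (\<pi> u))) \<and>
      (\<forall>u\<in>S. \<forall>v\<in>S. u \<in> P v \<longrightarrow> snd (\<pi> u) = 0 \<and> snd (\<pi> v) = 0) \<and>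
      (\<forall>i j k. i \<in> fst ` \<pi> ` S \<longrightarrow> k \<in> fst ` \<pi> ` S \<longrightarrow> i \<le> j \<longrightarrow> j \<le> k \<longrightarrow> j \<in> fst ` \<pi> ` S) \<and>
      (\<forall>v\<in>S. \<forall>u. (u, v) \<in> D \<longrightarrow> u \<in> S)" for S and \<pi> :: "'a \<Rightarrow> int \<times> nat"
  have edge_cases: "(u, v) \<in> D \<or> (v, u) \<in> D \<or> u \<in> P v \<and> v \<in> P u" if "{u, v} \<in> F" for u v
    using that by (auto simp: P_def insert_commute)
  \<comment> \<open>It suffices to find a free position \<open>p\<close> whose only occupied
    neighbour in the comb is that of \<open>w\<close>, in the direction required by the
    edge.\<close>
  have insert_inv: "\<exists>\<pi>'. inv (insert v S) \<pi>'"
    if I: "inv S \<pi>" and v: "v \<notin> S" "w \<in> S" "{v, w} \<in> F" "\<And>w'. w' \<in> S \<Longrightarrow> {v, w'} \<in> F \<Longrightarrow> w' = w"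
      and p: "p \<notin> \<pi> ` S" "\<And>x. x \<in> S \<Longrightarrow> comb_adj (\<pi> x) p \<longleftrightarrow> x = w"
        "\<And>d. snd p = Suc d \<Longrightarrow> (fst p, d) \<in> \<pi> ` S"
      and lab: "(w, v) \<in> D \<and> fst (\<pi> w) = fst p \<and> snd p = Suc (snd (\<pi> w)) \<or>
        w \<in> P v \<and> v \<in> P w \<and> snd (\<pi> w) = 0 \<and> snd p = 0"
      and near: "\<bar>fst p - fst (\<pi> w)\<bar> \<le> 1"
    for S \<pi> v w p
  proof -
    let ?p = "\<pi>(v := p)"
    have eq: "?p x = \<pi> x" if "x \<in> S" for x using that v by auto
    have img: "?p ` insert v S = insert p (\<pi> ` S)" using eq by force
    have SD: "x = w" if "x \<in> S" "(v, x) \<in> D \<or> (x, v) \<in> D \<or> x \<in> P v \<or> v \<in> P x" for x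
      using that v(4)[of x] D[of v x] D[of x v] insert_commute[of x v "{}"] unfolding P_def by auto
    have vv: "(v, v) \<notin> D" "v \<notin> P v" using D no_loop[of v] by (auto simp: P_def)
    have vw: "(v, w) \<notin> D" using lab D by (auto simp: P_def)
    have ad: "{x, v} \<in> F \<longleftrightarrow> comb_adj (\<pi> x) p" if "x \<in> S" for x
      using that p(2)[of x] v(3,4) by (auto simp: insert_commute)
    have emb: "comb_embedding (insert v S) F ?p" unfolding comb_embedding_def
    proof (intro conjI ballI allI impI)
      show "inj_on ?p (insert v S)"
      proof -
        have "inj_on \<pi> S" using I by (simp add: inv_def comb_embedding_def)
        then have "inj_on ?p S" using p(1) by (rule inj_on_fun_updI)
        moreover have "?p ` (S - {v}) \<subseteq> \<pi> ` S" by auto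
        ultimately show ?thesis using p(1) by (auto simp del: fun_upd_apply simp: fun_upd_same)
      qed
      show "(i, d) \<in> ?p ` insert v S" if "(i, Suc d) \<in> ?p ` insert v S" for i d
        using that I p(3)[of d] unfolding img inv_def comb_embedding_def by auto
      show "{x, y} \<in> F \<longleftrightarrow> comb_adj (?p x) (?p y)" if xy: "x \<in> insert v S" "y \<in> insert v S" for x y
      proof -
        consider "x = v" "y = v" | "x = v" "y \<in> S" | "x \<in> S" "y = v" | "x \<in> S" "y \<in> S"
          using xy by blast
        then show ?thesis
        proof cases
          case 1
          then show ?thesis using no_loop[of v] by simp
        next
          case 2
          then show ?thesis using ad[of y] eq[of y] by (simp add: insert_commute comb_adj_commute)
        next
          case 3
          then show ?thesis using ad[of x] eq[of x] by simp
        next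
          case 4
          then show ?thesis using I eq by (simp add: inv_def comb_embedding_def)
        qed
      qed
    qed
    have "inv (insert v S) ?p" unfolding inv_def
    proof (intro conjI; (intro ballI allI impI)?)
      show "comb_embedding (insert v S) F ?p" by (rule emb)
      show "fst (?p x) = fst (?p y) \<and> snd (?p y) = Suc (snd (?p x))"
        if xy: "x \<in> insert v S" "y \<in> insert v S" "(x, y) \<in> D" for x y
      proof -
        consider "x \<in> S" "y \<in> S" | "x = w" "y = v"
          using xy SD[of x] SD[of y] vv vw by blast
        then show ?thesis
        proof cases
          case 1
          then show ?thesis using I eq that by (simp add: inv_def)
        next
          case 2
          then show ?thesis using lab eq[OF v(2)] that by (auto simp: P_def)
        qed
      qed
      show "snd (?p x) = 0 \<and> snd (?p y) = 0"
        if xy: "x \<in> insert v S" "y \<in> insert v S" "x \<in> P y" for x y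
      proof -
        consider "x \<in> S" "y \<in> S" | "x = w" "y = v" | "x = v" "y = w"
          using xy SD[of x] SD[of y] vv by blast
        then show ?thesis
        proof cases
          case 1
          then show ?thesis using I eq that by (simp add: inv_def)
        next
          case 2
          then show ?thesis using lab eq[OF v(2)] that by (auto simp: P_def)
        next
          case 3
          then show ?thesis using lab eq[OF v(2)] that by (auto simp: P_def)
        qed
      qed
      show "j \<in> fst ` ?p ` insert v S"
        if "i \<in> fst ` ?p ` insert v S" "k \<in> fst ` ?p ` insert v S" "i \<le> j" "j \<le> k" for i j k
      proof -
        have old: "j \<in> fst ` \<pi> ` S" if "i \<in> fst ` \<pi> ` S" "k \<in> fst ` \<pi> ` S" "i \<le> j" "j \<le> k" for i k
          using I that unfolding inv_def by blast
        have w: "fst (\<pi> w) \<in> fst ` \<pi> ` S" using v by blast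
        have ik: "i = fst p \<or> i \<in> fst ` \<pi> ` S" "k = fst p \<or> k \<in> fst ` \<pi> ` S"
          using that(1,2) unfolding img by auto
        have "j = fst p \<or> j \<in> fst ` \<pi> ` S"
        proof (rule ccontr)
          assume n: "\<not> (j = fst p \<or> j \<in> fst ` \<pi> ` S)"
          have "j < fst (\<pi> w) \<or> fst (\<pi> w) < j" using n w by (metis linorder_neqE)
          then show False
          proof
            assume "j < fst (\<pi> w)"
            then have "i \<notin> fst ` \<pi> ` S" using old[of i "fst (\<pi> w)"] that w n by auto
            then show False using ik near that n \<open>j < fst (\<pi> w)\<close> by auto
          next
            assume "fst (\<pi> w) < j"
            then have "k \<notin> fst ` \<pi> ` S" using old[of "fst (\<pi> w)" k] that w n by auto
            then show False using ik near that n \<open>fst (\<pi> w) < j\<close> by auto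
          qed
        qed
        then show ?thesis unfolding img by auto
      qed
      show "x \<in> insert v S" if "y \<in> insert v S" "(x, y) \<in> D" for x y
      proof (cases "y = v")
        case True
        then show ?thesis using that lab in1[of x v w] excl[of x v w] v(2) by (auto simp: P_def)
      next
        case False
        then show ?thesis using that I by (auto simp: inv_def)
      qed
    qed
    then show ?thesis by blast
  qed
  obtain r where r: "r \<in> C" "\<forall>u\<in>C. (u, r) \<notin> D" using directed_tree_source[OF tree D] by blast
  from tree \<open>r \<in> C\<close> have "\<exists>\<pi>. inv C \<pi>"
  proof (induction rule: tree_growth_induct)
    case root
    have "(u, r) \<notin> D" for u using r(2) D tree_edge[OF tree] by blast
    moreover have "r \<notin> P r" using no_loop[of r] by (simp add: P_def)
    ultimately have "inv {r} (\<lambda>_. (0, 0))"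
      using no_loop[of r] by (auto simp: inv_def comb_embedding_def)
    then show ?case by blast
  next
    case (grow S v w)
    then obtain \<pi> where I: "inv S \<pi>" by blast
    have emb: "comb_embedding S F \<pi>" using I by (simp add: inv_def)
    have adj: "{x, y} \<in> F \<longleftrightarrow> comb_adj (\<pi> x) (\<pi> y)" if "x \<in> S" "y \<in> S" for x y
      using emb that by (simp add: comb_embedding_def)
    have down: "(i, d) \<in> \<pi> ` S" if "(i, Suc d) \<in> \<pi> ` S" for i d
      using emb that by (simp add: comb_embedding_def)
    have dirD: "fst (\<pi> x) = fst (\<pi> y)" "snd (\<pi> y) = Suc (snd (\<pi> x))"
      if "x \<in> S" "y \<in> S" "(x, y) \<in> D" for x y using I that by (simp_all add: inv_def)
    have undirD: "snd (\<pi> x) = 0" "snd (\<pi> y) = 0" if "x \<in> S" "y \<in> S" "x \<in> P y" for x y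
      using I that by (simp_all add: inv_def)
    have "v \<notin> S" using grow(3) by auto
    have "w \<in> S" by (rule grow(4))
    have "(v, w) \<notin> D" using I grow(3,4) by (auto simp: inv_def)
    then consider "(w, v) \<in> D" | "w \<in> P v" "v \<in> P w" using edge_cases[OF grow(5)] by blast
    then show ?case
    proof cases
      case 1
      obtain i d where id: "\<pi> w = (i, d)" by (metis surj_pair)
      \<comment> \<open>A vertex directly below \<open>w\<close> would be the end of a second edge
        leaving \<open>w\<close>.\<close>
      have free: "(i, Suc d) \<notin> \<pi> ` S"
      proof
        assume "(i, Suc d) \<in> \<pi> ` S"
        then obtain x where x: "x \<in> S" "\<pi> x = (i, Suc d)" by force
        then have "{w, x} \<in> F" using adj[of w x] \<open>w \<in> S\<close> id by (simp add: comb_adj_def)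
        then consider "(w, x) \<in> D" | "(x, w) \<in> D" | "x \<in> P w" using edge_cases by blast
        then show False
        proof cases
          case a: 1
          then show False using out1[OF 1] x \<open>v \<notin> S\<close> by blast
        next
          case 2
          then show False using dirD[of x w] x \<open>w \<in> S\<close> id by simp
        next
          case 3
          then show False using undirD[of x w] x \<open>w \<in> S\<close> by simp
        qed
      qed
      show ?thesis
      proof (rule insert_inv[OF I \<open>v \<notin> S\<close> \<open>w \<in> S\<close> grow(5,6) free])
        fix x assume x: "x \<in> S"
        show "comb_adj (\<pi> x) (i, Suc d) \<longleftrightarrow> x = w"
        proof
          assume "comb_adj (\<pi> x) (i, Suc d)"
          then have "\<pi> x = (i, Suc (Suc d)) \<or> \<pi> x = (i, d)"
            by (cases "\<pi> x") (auto simp: comb_adj_def)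
          moreover have "\<pi> x \<noteq> (i, Suc (Suc d))" using free down x by (metis image_eqI)
          ultimately have "\<pi> x = \<pi> w" using id by simp
          then show "x = w" using emb x \<open>w \<in> S\<close> by (auto simp: comb_embedding_def inj_on_def)
        qed (simp add: id comb_adj_def)
      qed (use 1 id \<open>w \<in> S\<close> in auto, metis image_eqI)
    next
      case 2
      \<comment> \<open>If \<open>w\<close> were off the spine, its edge from above would be
        incoming, which excludes the undirected edge to \<open>v\<close>.\<close>
      have "snd (\<pi> w) = 0"
      proof (cases "snd (\<pi> w)")
        case (Suc d)
        then obtain i where i: "\<pi> w = (i, Suc d)" by (metis prod.collapse)
        then have "(i, d) \<in> \<pi> ` S" using down[of i d] \<open>w \<in> S\<close> by (metis image_eqI)
        then obtain x where x: "x \<in> S" "\<pi> x = (i, d)" by force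
        then have "{x, w} \<in> F" using adj[of x w] \<open>w \<in> S\<close> i by (simp add: comb_adj_def)
        then consider "(w, x) \<in> D" | "(x, w) \<in> D" | "x \<in> P w" using edge_cases by blast
        then show ?thesis
        proof cases
          case 1
          then show ?thesis using dirD[of w x] x \<open>w \<in> S\<close> i by simp
        next
          case a: 2
          then show ?thesis using excl[OF a, of v] 2 by (simp add: P_def)
        next
          case 3
          then show ?thesis using undirD[of x w] x \<open>w \<in> S\<close> by simp
        qed
      qed simp
      then obtain i where i: "\<pi> w = (i, 0)" by (metis prod.collapse)
      have nb: "x \<in> P w \<and> x \<noteq> v" if x: "x \<in> S" "\<pi> x = (i + s, 0)" "s = 1 \<or> s = - 1" for x s
      proof -
        have "{x, w} \<in> F" using adj[of x w] x \<open>w \<in> S\<close> i by (auto simp: comb_adj_def)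
        moreover have "(x, w) \<notin> D" "(w, x) \<notin> D"
          using dirD[of x w] dirD[of w x] x \<open>w \<in> S\<close> i by auto
        ultimately show ?thesis using x \<open>v \<notin> S\<close> by (auto simp: P_def)
      qed
      \<comment> \<open>If both spine positions beside \<open>w\<close> were occupied,
        \<open>w\<close> would have three undirected neighbours including \<open>v\<close>.\<close>
      have "\<exists>s. (s = 1 \<or> s = - 1) \<and> (i + s, 0) \<notin> \<pi> ` S"
      proof (rule ccontr)
        assume "\<not> ?thesis"
        then have "(i + 1, 0) \<in> \<pi> ` S" "(i + - 1, 0) \<in> \<pi> ` S" by blast+
        then obtain x y where xy: "x \<in> S" "\<pi> x = (i + 1, 0)" "y \<in> S" "\<pi> y = (i + - 1, 0)"
          by (metis imageE)
        then have "{x, y, v} \<subseteq> P w" "x \<noteq> y" "x \<noteq> v" "y \<noteq> v"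
          using nb[of x 1] nb[of y "- 1"] 2 by auto
        then have "3 \<le> card (P w)" using card_mono[OF finP, of "{x, y, v}" w] by simp
        then show False using two[of w] grow(1,4) by (auto simp: P_def)
      qed
      then obtain s where s: "s = 1 \<or> s = - 1" "(i + s, 0) \<notin> \<pi> ` S" by blast
      have empty: "(i + s, d) \<notin> \<pi> ` S" for d using comb_embedding_root[OF emb] s by blast
      \<comment> \<open>Otherwise the interval of occupied columns would contain the empty column
        \<open>i + s\<close>.\<close>
      have far: "(i + 2 * s, 0) \<notin> \<pi> ` S"
      proof
        assume "(i + 2 * s, 0) \<in> \<pi> ` S"
        then have "i + 2 * s \<in> fst ` \<pi> ` S" by (metis fst_conv image_eqI)
        moreover have "i \<in> fst ` \<pi> ` S" using \<open>w \<in> S\<close> i by (metis fst_conv image_eqI)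
        moreover have "i \<le> i + s \<and> i + s \<le> i + 2 * s \<or> i + 2 * s \<le> i + s \<and> i + s \<le> i"
          using s by auto
        ultimately have "i + s \<in> fst ` \<pi> ` S" using I unfolding inv_def by blast
        then obtain d where "(i + s, d) \<in> \<pi> ` S" by (metis imageE prod.collapse)
        then show False using empty by blast
      qed
      show ?thesis
      proof (rule insert_inv[OF I \<open>v \<notin> S\<close> \<open>w \<in> S\<close> grow(5,6) s(2)])
        fix x assume x: "x \<in> S"
        show "comb_adj (\<pi> x) (i + s, 0) \<longleftrightarrow> x = w"
        proof
          assume "comb_adj (\<pi> x) (i + s, 0)"
          then have "\<pi> x = (i + s, 1) \<or> \<pi> x = (i, 0) \<or> \<pi> x = (i + 2 * s, 0)"
            using s(1) by (cases "\<pi> x") (auto simp: comb_adj_def)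
          moreover have "\<pi> x \<noteq> (i + s, 1)" "\<pi> x \<noteq> (i + 2 * s, 0)"
            using empty far x by (metis image_eqI)+
          ultimately have "\<pi> x = \<pi> w" using i by simp
          then show "x = w" using emb x \<open>w \<in> S\<close> by (auto simp: comb_embedding_def inj_on_def)
        qed (use s in \<open>auto simp: i comb_adj_def\<close>)
      qed (use 2 i s in auto)
    qed
  qed
  then obtain \<pi> where "inv C \<pi>" by blast
  then have "comb_embedding C F \<pi>" by (simp add: inv_def)
  then show ?thesis by blast
qed

section \<open>Bars and their columns\<close>

definition bar :: "real \<Rightarrow> real \<Rightarrow> (real \<times> real) set" where
  "bar x y = {x..x + 1} \<times> {y}"

lemma is_bar_bar [simp]: "is_bar (bar x y)"
  by (auto simp: is_bar_def bar_def)

lemma bar_eq_iff [simp]: "bar x y = bar x' y' \<longleftrightarrow> x = x' \<and> y = y'"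
proof
  assume eq: "bar x y = bar x' y'"
  have "(x, y) \<in> bar x y" "(x', y') \<in> bar x' y'" by (simp_all add: bar_def)
  then have "(x, y) \<in> bar x' y'" "(x', y') \<in> bar x y" using eq by simp_all
  then show "x = x' \<and> y = y'" by (auto simp: bar_def)
qed simp

section \<open>Columns of a representation as lazy walks\<close>

lemma lazy_walk_conn:
  assumes "successively (\<lambda>u v. u = v \<or> {u, v} \<in> E) ws"
  shows "conn E (set ws)"
  using assms
proof (induction ws rule: induct_list012)
  case (3 u v ws)
  then show ?case using conn_insert[of E "set (v # ws)" v u] by (auto simp: insert_absorb)
qed (simp_all add: conn_def)

text \<open>The k occurrences of \<open>v\<close> cut the walk into k + 1 pieces avoiding
  \<open>v\<close>. Each piece is connected, so it contains at most one neighbour of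
  \<open>v\<close>.\<close>

lemma lazy_walk_neighbours:
  assumes tree: "is_tree V E" and "successively (\<lambda>u v. u = v \<or> {u, v} \<in> E) ws"
  shows "card {u \<in> set ws. {u, v} \<in> E} \<le> length (filter (\<lambda>w. w = v) ws) + 1"
  using assms(2)
proof (induction "length ws" arbitrary: ws rule: less_induct)
  case less
  have ac: "\<nexists>xs. is_cycle E xs" and loop: "{v} \<notin> E"
    using tree tree_edge(3)[OF tree, of v v] by (auto simp: is_tree_def)
  have single: "card {u \<in> set ys. {u, v} \<in> E} \<le> 1"
    if "successively (\<lambda>u v. u = v \<or> {u, v} \<in> E) ys" "v \<notin> set ys" for ys
    using unique_attachment[OF ac lazy_walk_conn[OF that(1)] that(2)]
    by (simp add: card_le_Suc0_iff_eq insert_commute)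
  show ?case
  proof (cases "v \<in> set ws")
    case True
    then obtain ys zs where ws: "ws = ys @ v # zs" "v \<notin> set ys" by (meson split_list_first)
    have "successively (\<lambda>u v. u = v \<or> {u, v} \<in> E) ys" "successively (\<lambda>u v. u = v \<or> {u, v} \<in> E) zs"
      using less.prems unfolding ws
      by (auto simp: successively_append_iff successively_Cons split: if_splits)
    then have "card {u \<in> set ys. {u, v} \<in> E} \<le> 1"
      "card {u \<in> set zs. {u, v} \<in> E} \<le> length (filter (\<lambda>w. w = v) zs) + 1"
      using single ws less.hyps[of zs] by auto
    moreover have "{u \<in> set ws. {u, v} \<in> E} = {u \<in> set ys. {u, v} \<in> E} \<union> {u \<in> set zs. {u, v} \<in> E}"
      unfolding ws using loop by auto
    moreover have "card ({u \<in> set ys. {u, v} \<in> E} \<union> {u \<in> set zs. {u, v} \<in> E}) \<le>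
        card {u \<in> set ys. {u, v} \<in> E} + card {u \<in> set zs. {u, v} \<in> E}" by (rule card_Un_le)
    ultimately show ?thesis unfolding ws by simp
  next
    case False
    then show ?thesis using single[OF less.prems] by simp
  qed
qed

text \<open>The walk lists the owners of the bars over \<open>x\<close> by increasing height.
  Consecutive bars see each other, so their owners are equal or adjacent. \<open>Q\<close> encodes a
  bar by its left end and height.\<close>

lemma column_is_lazy_walk:
  assumes rep: "unit_bar_rep t V E \<phi>" and "finite V"
  defines "Q \<equiv> \<lambda>v. {q. bar (fst q) (snd q) \<in> \<phi> v}"
  shows "\<exists>ws. successively (\<lambda>u v. u = v \<or> {u, v} \<in> E) ws \<and> set ws = rcut V (\<lambda>v. fst ` Q v) x \<and>
    (\<forall>v\<in>V. length (filter (\<lambda>w. w = v) ws) \<le> card {q \<in> Q v. fst q \<le> x \<and> x < fst q + 1})"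
proof -
  have fin: "finite (Q v)" if "v \<in> V" for v
  proof (rule inj_on_finite)
    show "inj_on (\<lambda>q. bar (fst q) (snd q)) (Q v)" by (auto simp: inj_on_def)
    show "(\<lambda>q. bar (fst q) (snd q)) ` Q v \<subseteq> \<phi> v" by (auto simp: Q_def)
    show "finite (\<phi> v)" using rep that by (simp add: unit_bar_rep_def)
  qed
  define A where "A v = {q \<in> Q v. fst q \<le> x \<and> x < fst q + 1}" for v
  define H where "H = (\<Union>v\<in>V. snd ` A v)"
  define lab where "lab h = (SOME v. v \<in> V \<and> h \<in> snd ` A v)" for h
  have finH: "finite H" unfolding H_def A_def using \<open>finite V\<close> fin by auto
  have same: "u = v \<and> p = q" if "u \<in> V" "v \<in> V" "p \<in> A u" "q \<in> A v" "snd p = snd q" for u v p q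
  proof -
    have "(x, snd p) \<in> bar (fst p) (snd p) \<inter> bar (fst q) (snd q)"
      using that by (auto simp: A_def bar_def)
    then have "(u, bar (fst p) (snd p)) = (v, bar (fst q) (snd q))"
      using rep that unfolding unit_bar_rep_def A_def Q_def by blast
    then show ?thesis by (simp add: prod_eq_iff)
  qed
  have labH: "lab h \<in> V \<and> h \<in> snd ` A (lab h)" if "h \<in> H" for h
    using that unfolding lab_def H_def by (metis (mono_tags, lifting) UN_E someI_ex)
  have lab_eq: "lab h = v" if "v \<in> V" "h \<in> snd ` A v" for v h
  proof -
    have "h \<in> H" using that by (auto simp: H_def)
    then show ?thesis using labH[of h] same[of "lab h" v] that by force
  qed
  define hs where "hs = sorted_list_of_set H"
  have hs: "set hs = H" "distinct hs" "sorted hs" using finH by (simp_all add: hs_def)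
  have step: "lab (hs ! i) = lab (hs ! Suc i) \<or> {lab (hs ! i), lab (hs ! Suc i)} \<in> E"
    if i: "Suc i < length hs" for i
  proof -
    let ?c = "hs ! i" and ?d = "hs ! Suc i"
    have H: "?c \<in> H" "?d \<in> H" using i hs(1) by (auto simp flip: hs(1))
    have "?c < ?d" using i hs(2,3) by (simp add: sorted_nth_mono nth_eq_iff_index_eq order_less_le)
    have gap: "\<not> (?c < h \<and> h < ?d)" if "h \<in> H" for h
    proof
      assume h: "?c < h \<and> h < ?d"
      obtain j where j: "j < length hs" "h = hs ! j" using \<open>h \<in> H\<close> hs(1) by (metis in_set_conv_nth)
      then have "i < j" using h sorted_nth_mono[OF hs(3), of j i] i by (meson not_less order.strict_implies_order Suc_lessD leD)
      moreover have "j < Suc i" using h j sorted_nth_mono[OF hs(3), of "Suc i" j] by (meson leD not_less)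
      ultimately show False by simp
    qed
    obtain p where p: "p \<in> A (lab ?c)" "snd p = ?c" using labH[OF H(1)] by auto
    obtain q where q: "q \<in> A (lab ?d)" "snd q = ?d" using labH[OF H(2)] by auto
    \<comment> \<open>Up to \<open>x'\<close> no further bar starts and neither of the two bars
      ends, so the thin rectangle between them over \<open>x\<close> and \<open>x'\<close> is
      free.\<close>
    obtain x' where x': "x < x'" "\<And>b. b \<in> (\<Union>v\<in>V. fst ` Q v) \<union> {fst p + 1, fst q + 1} \<Longrightarrow> x < b \<Longrightarrow> x' < b"
      using finite_gap_right[of "(\<Union>v\<in>V. fst ` Q v) \<union> {fst p + 1, fst q + 1}" x] \<open>finite V\<close> fin by auto
    have pq: "fst p \<le> x" "x < fst p + 1" "fst q \<le> x" "x < fst q + 1" using p q by (auto simp: A_def)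
    then have x'pq: "x' < fst p + 1" "x' < fst q + 1" using x' by auto
    have "sees_upward (\<Union>w\<in>V. \<phi> w) (bar (fst p) (snd p)) (bar (fst q) (snd q))"
      unfolding sees_upward_def
    proof (intro exI conjI ballI)
      show "x < x'" "?c < ?d" by fact+
      show "{x..x'} \<times> {?c} \<subseteq> bar (fst p) (snd p)" "{x..x'} \<times> {?d} \<subseteq> bar (fst q) (snd q)"
        using p(2) q(2) pq x'pq by (auto simp: bar_def)
      fix B assume "B \<in> (\<Union>w\<in>V. \<phi> w)"
      then obtain v where v: "v \<in> V" "B \<in> \<phi> v" by blast
      then have "is_bar B" using rep by (simp add: unit_bar_rep_def)
      then obtain b y where B: "B = bar b y" by (auto simp: is_bar_def bar_def)
      show "({x<..<x'} \<times> {?c<..<?d}) \<inter> B = {}"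
      proof (rule ccontr)
        assume "({x<..<x'} \<times> {?c<..<?d}) \<inter> B \<noteq> {}"
        then obtain z where z: "x < z" "z < x'" "?c < y" "y < ?d" "b \<le> z" "z \<le> b + 1"
          by (auto simp: B bar_def)
        have Qb: "(b, y) \<in> Q v" using v B by (simp add: Q_def)
        then have "b \<in> (\<Union>v\<in>V. fst ` Q v)" using v by force
        then have "b \<le> x" using x'(2)[of b] z by force
        then have "(b, y) \<in> A v" using Qb z by (simp add: A_def)
        then have "y \<in> H" using v by (force simp: H_def)
        then show False using gap z by blast
      qed
    qed
    moreover have "bar (fst p) (snd p) \<in> \<phi> (lab ?c)" "bar (fst q) (snd q) \<in> \<phi> (lab ?d)"
      using p q by (auto simp: A_def Q_def)
    ultimately show ?thesis
      using rep labH[OF H(1)] labH[OF H(2)] unfolding unit_bar_rep_def sees_def by metis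
  qed
  show ?thesis
  proof (intro exI conjI ballI)
    show "successively (\<lambda>u v. u = v \<or> {u, v} \<in> E) (map lab hs)"
      using step by (simp add: successively_conv_nth)
    have "lab ` H = {v \<in> V. A v \<noteq> {}}"
    proof (intro equalityI subsetI)
      fix v assume "v \<in> {v \<in> V. A v \<noteq> {}}"
      then obtain q where "v \<in> V" "q \<in> A v" by blast
      then have "snd q \<in> H" "lab (snd q) = v" using lab_eq by (auto simp: H_def)
      then show "v \<in> lab ` H" by blast
    qed (use labH in force)
    also have "\<dots> = rcut V (\<lambda>v. fst ` Q v) x" unfolding rcut_def A_def by blast
    finally show "set (map lab hs) = rcut V (\<lambda>v. fst ` Q v) x" using hs(1) by simp
    fix v assume "v \<in> V"
    have "length (filter (\<lambda>w. w = v) (map lab hs)) = length (filter (\<lambda>h. lab h = v) hs)"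
      by (simp add: filter_map o_def)
    also have "\<dots> = card {h \<in> H. lab h = v}"
      using hs distinct_card[of "filter (\<lambda>h. lab h = v) hs"] by simp
    also have "\<dots> \<le> card (snd ` A v)"
      using labH fin[OF \<open>v \<in> V\<close>] by (intro card_mono) (auto simp: A_def)
    also have "\<dots> \<le> card (A v)" using fin[OF \<open>v \<in> V\<close>] by (intro card_image_le) (simp add: A_def)
    finally show "length (filter (\<lambda>w. w = v) (map lab hs)) \<le> card {q \<in> Q v. fst q \<le> x \<and> x < fst q + 1}"
      by (simp add: A_def)
  qed
qed

lemma unit_bar_rep_balanced:
  assumes tree: "is_tree V E" and rep: "unit_bar_rep t V E \<phi>"
  shows "\<exists>D. balanced t V E D"
proof -
  define Q where "Q v = {q. bar (fst q) (snd q) \<in> \<phi> v}" for v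
  have finV: "finite V" using tree by (auto simp: is_tree_def simple_graph_def)
  have inj: "inj_on (\<lambda>q. bar (fst q) (snd q)) (Q v)" for v by (auto simp: inj_on_def)
  have img: "(\<lambda>q. bar (fst q) (snd q)) ` Q v \<subseteq> \<phi> v" for v by (auto simp: Q_def)
  have vis: "\<forall>u\<in>V. \<forall>v\<in>V. u \<noteq> v \<longrightarrow>
      ({u, v} \<in> E \<longleftrightarrow> (\<exists>B\<in>\<phi> u. \<exists>C\<in>\<phi> v. sees (\<Union>w\<in>V. \<phi> w) B C))"
    using rep unfolding unit_bar_rep_def by (elim conjE)
  note walk = column_is_lazy_walk[OF rep finV, folded Q_def]
  show ?thesis
  proof (rule sweep_balanced[OF tree, where Q = Q and lft = fst])
    fix v assume "v \<in> V"
    then have \<phi>: "finite (\<phi> v)" "card (\<phi> v) \<le> t" using rep by (auto simp: unit_bar_rep_def)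
    show "finite (Q v)" using inj_on_finite[OF inj img \<phi>(1)] .
    show "card (Q v) \<le> t" using card_inj_on_le[OF inj img \<phi>(1)] \<phi>(2) by simp
    show "card {u \<in> rcut V (\<lambda>v. fst ` Q v) x. {u, v} \<in> E} \<le>
        card {q \<in> Q v. fst q \<le> x \<and> x < fst q + 1} + 1" for x
    proof -
      obtain ws where "successively (\<lambda>u v. u = v \<or> {u, v} \<in> E) ws"
        "set ws = rcut V (\<lambda>v. fst ` Q v) x"
        "length (filter (\<lambda>w. w = v) ws) \<le> card {q \<in> Q v. fst q \<le> x \<and> x < fst q + 1}"
        using walk[of x] \<open>v \<in> V\<close> by blast
      then show ?thesis using lazy_walk_neighbours[OF tree, of ws v] by simp
    qed
  next
    fix x
    obtain ws where "successively (\<lambda>u v. u = v \<or> {u, v} \<in> E) ws" "set ws = rcut V (\<lambda>v. fst ` Q v) x"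
      using walk[of x] by blast
    then show "conn E (rcut V (\<lambda>v. fst ` Q v) x)" using lazy_walk_conn[of E ws] by simp
  next
    fix e assume e: "e \<in> E"
    obtain u v where uv: "e = {u, v}" "u \<noteq> v" "u \<in> V" "v \<in> V" using tree_edge_obtain[OF tree e] by metis
    then obtain B C where BC: "B \<in> \<phi> u" "C \<in> \<phi> v" "sees (\<Union>w\<in>V. \<phi> w) B C"
      using vis e by blast
    then have "is_bar B" "is_bar C" using rep uv by (auto simp: unit_bar_rep_def)
    then obtain b y c z where bars: "B = bar b y" "C = bar c z" by (auto simp: is_bar_def bar_def)
    \<comment> \<open>Positive width places the left side of the rectangle strictly before the right
      ends of both bars.\<close>
    have "\<exists>x. b \<le> x \<and> x < b + 1 \<and> c \<le> x \<and> x < c + 1"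
    proof -
      obtain l r h k where "l < r" "{l..r} \<times> {h} \<subseteq> B" "{l..r} \<times> {k} \<subseteq> C"
        using BC(3) unfolding sees_def sees_upward_def by blast
      then have "(l, h) \<in> B" "(r, h) \<in> B" "(l, k) \<in> C" "(r, k) \<in> C" by auto
      then show ?thesis using \<open>l < r\<close> bars by (intro exI[of _ l]) (auto simp: bar_def)
    qed
    then obtain x where x: "b \<le> x" "x < b + 1" "c \<le> x" "x < c + 1" by blast
    have "(b, y) \<in> Q u" "(c, z) \<in> Q v" using BC bars by (auto simp: Q_def)
    then have "u \<in> rcut V (\<lambda>v. fst ` Q v) x" "v \<in> rcut V (\<lambda>v. fst ` Q v) x"
      using x uv unfolding rcut_def by force+
    then show "\<exists>x. e \<subseteq> rcut V (\<lambda>v. fst ` Q v) x" using uv by blast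
  qed
qed


section \<open>Drawing combs\<close>

text \<open>Spine bars alternate between heights \<open>0\<close> and \<open>1\<close>, and teeth
  lead away from the other level. Hence neighbouring teeth are shielded from each other by their
  spine bars.\<close>

lemma comb_embedding_unit_bar_rep:
  assumes emb: "comb_embedding C F \<pi>"
  shows "\<exists>\<phi>. unit_bar_rep 1 C F \<phi>"
proof -
  \<comment> \<open>With spacing 3/5, bars of neighbouring columns overlap horizontally, while
    columns two apart are at distance 6/5 and cannot meet.\<close>
  define X where "X p = 3 * real_of_int (fst p) / 5" for p :: "int \<times> nat"
  define Y where "Y p = (if even (fst p) then - int (snd p) else 1 + int (snd p))" for p :: "int \<times> nat"
  define b where "b p = bar (X p) (real_of_int (Y p))" for p
  have down: "(i, d) \<in> \<pi> ` C" if "(i, Suc d) \<in> \<pi> ` C" for i d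
    using emb that by (simp add: comb_embedding_def)
  have down': "(i, e) \<in> \<pi> ` C" if "(i, d) \<in> \<pi> ` C" "e \<le> d" for i d e
    using that(2,1) by (induction rule: inc_induct) (use down in auto)
  define \<A> where "\<A> = (\<Union>w\<in>C. {b (\<pi> w)})"
  have disj: "p = q" if pq: "b p \<inter> b q \<noteq> {}" for p q
  proof -
    obtain z where "z \<in> b p" "z \<in> b q" using pq by blast
    then have x: "X p \<le> fst z" "fst z \<le> X p + 1" "X q \<le> fst z" "fst z \<le> X q + 1" and Y: "Y p = Y q"
      by (auto simp: b_def bar_def)
    have "\<bar>fst p - fst q\<bar> < 2" using x by (simp add: X_def)
    moreover have "even (fst p) \<longleftrightarrow> even (fst q)" using Y by (auto simp: Y_def split: if_splits)
    ultimately have "fst p = fst q" by presburger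
    then show ?thesis using Y by (auto simp: Y_def prod_eq_iff split: if_splits)
  qed
  have up: "comb_adj p q" if pq: "p \<in> \<pi> ` C" "q \<in> \<pi> ` C" and see: "sees_upward \<A> (b p) (b q)" for p q
  proof -
    obtain l r h k where lr: "l < r" "h < k" "{l..r} \<times> {h} \<subseteq> b p" "{l..r} \<times> {k} \<subseteq> b q"
      and free: "\<forall>B\<in>\<A>. ({l<..<r} \<times> {h<..<k}) \<inter> B = {}"
      using see unfolding sees_upward_def by (elim exE conjE)
    have "(l, h) \<in> b p" "(r, h) \<in> b p" "(l, k) \<in> b q" "(r, k) \<in> b q" using lr by auto
    then have pl: "X p \<le> l" "r \<le> X p + 1" "h = Y p" "X q \<le> l" "r \<le> X q + 1" "k = Y q"
      by (auto simp: b_def bar_def)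
    then have Y: "Y p < Y q" using lr by simp
    \<comment> \<open>A bar in the column of \<open>p\<close> or of \<open>q\<close> spans the whole
      width of the rectangle and would block it.\<close>
    have free': "\<not> (Y p < Y s \<and> Y s < Y q)" if s: "s \<in> \<pi> ` C" "X s = X p \<or> X s = X q" for s
    proof
      assume "Y p < Y s \<and> Y s < Y q"
      then have "((l + r) / 2, real_of_int (Y s)) \<in> ({l<..<r} \<times> {h<..<k}) \<inter> b s"
        using pl s(2) lr(1) by (auto simp: b_def bar_def)
      moreover have "b s \<in> \<A>" using s by (auto simp: \<A>_def)
      ultimately show False using free by blast
    qed
    obtain i d j e where ij: "p = (i, d)" "q = (j, e)" by (metis surj_pair)
    have "\<bar>i - j\<bar> < 2" using pl lr ij by (simp add: X_def)
    then consider "i = j" | "j = i + 1 \<or> i = j + 1" by linarith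
    then show ?thesis
    proof cases
      case 1
      then have X: "X (i, c) = X p" for c by (simp add: X_def ij)
      show ?thesis
      proof (cases "even i")
        case True
        then have "e < d" using Y 1 ij by (simp add: Y_def)
        moreover have "\<not> Suc e < d"
          using free'[of "(i, Suc e)"] down'[of i d "Suc e"] X pq True 1 ij by (auto simp: Y_def)
        ultimately show ?thesis using 1 ij by (simp add: comb_adj_def)
      next
        case False
        then have "d < e" using Y 1 ij by (simp add: Y_def)
        moreover have "\<not> Suc d < e"
          using free'[of "(i, Suc d)"] down'[of i e "Suc d"] X pq False 1 ij by (auto simp: Y_def)
        ultimately show ?thesis using 1 ij by (simp add: comb_adj_def)
      qed
    next
      case 2
      then have par: "even i \<longleftrightarrow> odd j" by auto
      have "even i" using Y par ij by (auto simp: Y_def)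
      then have "odd j" using par by simp
      \<comment> \<open>The spine bars of both columns are present at heights \<open>0\<close> and
        \<open>1\<close>, so only they can see each other.\<close>
      have mem: "(i, 0) \<in> \<pi> ` C" "(j, 0) \<in> \<pi> ` C" using down' pq ij by auto
      have X: "X (i, 0) = X p" "X (j, 0) = X q" by (simp_all add: X_def ij)
      have Ys: "Y p = - int d" "Y q = 1 + int e" "Y (i, 0) = 0" "Y (j, 0) = 1"
        using \<open>even i\<close> \<open>odd j\<close> by (simp_all add: Y_def ij)
      have "d = 0" using free'[OF mem(1)] X Ys by simp
      moreover have "e = 0" using free'[OF mem(2)] X Ys by simp
      ultimately show ?thesis using 2 ij by (auto simp: comb_adj_def)
    qed
  qed
  \<comment> \<open>Heights are integers, so nothing lies strictly between consecutive ones.\<close>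
  have up_conv: "sees_upward \<A> (b p) (b q)" if "comb_adj p q" "Y q = Y p + 1" for p q
  proof -
    have "\<bar>fst p - fst q\<bar> \<le> 1" using that by (auto simp: comb_adj_def)
    then have "\<bar>X p - X q\<bar> < 1" by (simp add: X_def)
    moreover have "({max (X p) (X q)<..<min (X p) (X q) + 1} \<times> {real_of_int (Y p)<..<real_of_int (Y q)}) \<inter> B = {}"
      if B: "B \<in> \<A>" for B
    proof -
      obtain s where "B = b s" using B unfolding \<A>_def by blast
      moreover have "\<not> (real_of_int (Y p) < real_of_int (Y s) \<and> real_of_int (Y s) < real_of_int (Y q))"
        using \<open>Y q = Y p + 1\<close> by (simp only: of_int_less_iff) linarith
      ultimately show ?thesis by (auto simp: b_def bar_def)
    qed
    moreover have "{max (X p) (X q)..min (X p) (X q) + 1} \<times> {real_of_int (Y s)} \<subseteq> b s"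
      if "s = p \<or> s = q" for s
      using that by (auto simp: b_def bar_def)
    moreover have "real_of_int (Y p) < real_of_int (Y q)" using \<open>Y q = Y p + 1\<close> by simp
    moreover have "max (X p) (X q) < min (X p) (X q) + 1"
      using \<open>\<bar>X p - X q\<bar> < 1\<close> by (auto simp: max_def min_def abs_less_iff)
    ultimately show ?thesis unfolding sees_upward_def by blast
  qed
  have sees_iff: "sees \<A> (b p) (b q) \<longleftrightarrow> comb_adj p q" if "p \<in> \<pi> ` C" "q \<in> \<pi> ` C" for p q
  proof
    assume "sees \<A> (b p) (b q)"
    then show "comb_adj p q" using up that comb_adj_commute unfolding sees_def by blast
  next
    assume a: "comb_adj p q"
    then have "Y q = Y p + 1 \<or> Y p = Y q + 1"
      by (auto simp: comb_adj_def Y_def)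
    then show "sees \<A> (b p) (b q)"
      using up_conv a comb_adj_commute unfolding sees_def by blast
  qed
  have "unit_bar_rep 1 C F (\<lambda>v. {b (\<pi> v)})"
    unfolding unit_bar_rep_def
  proof (intro conjI ballI impI)
    fix u v B D assume "u \<in> C" "v \<in> C" "B \<in> {b (\<pi> u)}" "D \<in> {b (\<pi> v)}" "(u, B) \<noteq> (v, D)"
    then show "B \<inter> D = {}" using disj[of "\<pi> u" "\<pi> v"] emb
      by (auto simp: comb_embedding_def inj_on_def)
  next
    fix u v assume "u \<in> C" "v \<in> C" "u \<noteq> v"
    then show "{u, v} \<in> F \<longleftrightarrow> (\<exists>B\<in>{b (\<pi> u)}. \<exists>D\<in>{b (\<pi> v)}. sees (\<Union>w\<in>C. {b (\<pi> w)}) B D)"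
      using sees_iff emb by (simp add: comb_embedding_def \<A>_def)
  qed (simp_all add: b_def)
  then show ?thesis by blast
qed

section \<open>Placing representations side by side\<close>

text \<open>Dropping the bound \<open>t\<close> allows the bars to be counted vertex by vertex when
  representations are united.\<close>

definition bar_rep :: "'a set \<Rightarrow> 'a set set \<Rightarrow> ('a \<Rightarrow> (real \<times> real) set set) \<Rightarrow> bool" where
  "bar_rep V E \<phi> \<longleftrightarrow>
     (\<forall>v\<in>V. finite (\<phi> v) \<and> (\<forall>B\<in>\<phi> v. is_bar B)) \<and>
     (\<forall>u\<in>V. \<forall>v\<in>V. \<forall>B\<in>\<phi> u. \<forall>C\<in>\<phi> v. (u, B) \<noteq> (v, C) \<longrightarrow> B \<inter> C = {}) \<and>
     (\<forall>u\<in>V. \<forall>v\<in>V. u \<noteq> v \<longrightarrow>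
        ({u, v} \<in> E \<longleftrightarrow> (\<exists>B\<in>\<phi> u. \<exists>C\<in>\<phi> v. sees (\<Union>w\<in>V. \<phi> w) B C)))"

lemma unit_bar_rep_iff: "unit_bar_rep t V E \<phi> \<longleftrightarrow> bar_rep V E \<phi> \<and> (\<forall>v\<in>V. card (\<phi> v) \<le> t)"
  unfolding unit_bar_rep_def bar_rep_def by (simp only: ball_conj_distrib conj_ac)

lemma bar_repI:
  assumes "\<And>v. v \<in> V \<Longrightarrow> finite (\<phi> v)" "\<And>v B. v \<in> V \<Longrightarrow> B \<in> \<phi> v \<Longrightarrow> is_bar B"
    and "\<And>u v B C. u \<in> V \<Longrightarrow> v \<in> V \<Longrightarrow> B \<in> \<phi> u \<Longrightarrow> C \<in> \<phi> v \<Longrightarrow> (u, B) \<noteq> (v, C) \<Longrightarrow> B \<inter> C = {}"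
    and "\<And>u v. u \<in> V \<Longrightarrow> v \<in> V \<Longrightarrow> u \<noteq> v \<Longrightarrow>
      {u, v} \<in> E \<longleftrightarrow> (\<exists>B\<in>\<phi> u. \<exists>C\<in>\<phi> v. sees (\<Union>w\<in>V. \<phi> w) B C)"
  shows "bar_rep V E \<phi>"
  unfolding bar_rep_def using assms(1,2) assms(3,4) by (intro conjI ballI impI) auto

lemma bar_repD:
  assumes "bar_rep V E \<phi>"
  shows "\<And>v. v \<in> V \<Longrightarrow> finite (\<phi> v)" "\<And>v B. v \<in> V \<Longrightarrow> B \<in> \<phi> v \<Longrightarrow> is_bar B"
    and "\<And>u v B C. u \<in> V \<Longrightarrow> v \<in> V \<Longrightarrow> B \<in> \<phi> u \<Longrightarrow> C \<in> \<phi> v \<Longrightarrow> (u, B) \<noteq> (v, C) \<Longrightarrow> B \<inter> C = {}"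
    and "\<And>u v. u \<in> V \<Longrightarrow> v \<in> V \<Longrightarrow> u \<noteq> v \<Longrightarrow>
      {u, v} \<in> E \<longleftrightarrow> (\<exists>B\<in>\<phi> u. \<exists>C\<in>\<phi> v. sees (\<Union>w\<in>V. \<phi> w) B C)"
  using assms unfolding bar_rep_def by simp_all

definition shift :: "real \<Rightarrow> (real \<times> real) set \<Rightarrow> (real \<times> real) set" where
  "shift h B = {p. (fst p - h, snd p) \<in> B}"

lemma shift_bar: "shift h (bar x y) = bar (x + h) y"
  by (auto simp: shift_def bar_def)

lemma shift_shift: "shift (- h) (shift h B) = B"
  by (auto simp: shift_def)

lemma is_bar_shift: "is_bar B \<Longrightarrow> is_bar (shift h B)"
  by (metis is_bar_def bar_def shift_bar)

lemma shift_Int: "shift h B \<inter> shift h C = shift h (B \<inter> C)"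
  by (auto simp: shift_def)

lemma sees_upward_shiftI:
  assumes "sees_upward \<A> B C"
  shows "sees_upward (shift h ` \<A>) (shift h B) (shift h C)"
proof -
  obtain l r c d where *: "l < r" "c < d" "{l..r} \<times> {c} \<subseteq> B" "{l..r} \<times> {d} \<subseteq> C"
    "\<forall>D\<in>\<A>. ({l<..<r} \<times> {c<..<d}) \<inter> D = {}"
    using assms unfolding sees_upward_def by blast
  have "({l + h<..<r + h} \<times> {c<..<d}) \<inter> shift h D = {}" if "D \<in> \<A>" for D
  proof (rule ccontr)
    assume "({l + h<..<r + h} \<times> {c<..<d}) \<inter> shift h D \<noteq> {}"
    then obtain p where "p \<in> {l + h<..<r + h} \<times> {c<..<d}" "p \<in> shift h D" by blast
    then have "(fst p - h, snd p) \<in> ({l<..<r} \<times> {c<..<d}) \<inter> D" by (auto simp: shift_def)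
    then show False using *(5) that by blast
  qed
  moreover have "{l + h..r + h} \<times> {e} \<subseteq> shift h X" if "{l..r} \<times> {e} \<subseteq> X" for e X
    using that by (auto simp: shift_def)
  moreover have "l + h < r + h" using *(1) by simp
  ultimately show ?thesis unfolding sees_upward_def using *(2-4) by blast
qed

lemma sees_shift: "sees (shift h ` \<A>) (shift h B) (shift h C) \<longleftrightarrow> sees \<A> B C"
proof -
  have "sees_upward (shift h ` \<A>) (shift h B) (shift h C) \<longleftrightarrow> sees_upward \<A> B C" for B C
    using sees_upward_shiftI[of \<A> B C h]
      sees_upward_shiftI[of "shift h ` \<A>" "shift h B" "shift h C" "- h"]
    by (auto simp: shift_shift image_image)
  then show ?thesis by (simp add: sees_def)
qed

lemma bar_rep_shift:
  assumes "bar_rep V E \<phi>"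
  shows "bar_rep V E (\<lambda>v. shift h ` \<phi> v)"
proof (rule bar_repI)
  fix u v B C assume *: "u \<in> V" "v \<in> V" "B \<in> shift h ` \<phi> u" "C \<in> shift h ` \<phi> v" "(u, B) \<noteq> (v, C)"
  then obtain B' C' where BC: "B = shift h B'" "C = shift h C'" "B' \<in> \<phi> u" "C' \<in> \<phi> v" by blast
  then have "B' \<inter> C' = {}" using bar_repD(3)[OF assms *(1,2)] *(5) by blast
  then have "shift h B' \<inter> shift h C' = {}" unfolding shift_Int by (simp add: shift_def)
  then show "B \<inter> C = {}" using BC by simp
next
  fix u v assume "u \<in> V" "v \<in> V" "u \<noteq> v"
  moreover have "(\<Union>w\<in>V. shift h ` \<phi> w) = shift h ` (\<Union>w\<in>V. \<phi> w)" by blast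
  ultimately show "{u, v} \<in> E \<longleftrightarrow>
      (\<exists>B\<in>shift h ` \<phi> u. \<exists>C\<in>shift h ` \<phi> v. sees (\<Union>w\<in>V. shift h ` \<phi> w) B C)"
    using bar_repD(4)[OF assms] by (simp add: sees_shift)
qed (use bar_repD(1,2)[OF assms] in \<open>auto intro: is_bar_shift\<close>)

definition x_disjoint :: "(real \<times> real) set \<Rightarrow> (real \<times> real) set \<Rightarrow> bool" where
  "x_disjoint B C \<longleftrightarrow> fst ` B \<inter> fst ` C = {}"

text \<open>The rectangle stands on \<open>B\<close>, so a bar horizontally disjoint from
  \<open>B\<close> cannot meet its interior.\<close>

lemma sees_upward_Un:
  assumes "\<And>D. D \<in> \<B> \<Longrightarrow> x_disjoint B D"
  shows "sees_upward (\<A> \<union> \<B>) B C \<longleftrightarrow> sees_upward \<A> B C"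
proof -
  have "({l<..<r} \<times> {c<..<d}) \<inter> D = {}" if "{l..r} \<times> {c} \<subseteq> B" "D \<in> \<B>" for l r c d D
  proof (rule ccontr)
    assume "({l<..<r} \<times> {c<..<d}) \<inter> D \<noteq> {}"
    then obtain p where p: "p \<in> D" "l < fst p" "fst p < r" by auto
    then have "(fst p, c) \<in> B" using that(1) by auto
    then have "fst p \<in> fst ` B \<inter> fst ` D" using p by (metis IntI fst_conv image_eqI)
    then show False using assms[OF that(2)] unfolding x_disjoint_def by blast
  qed
  then show ?thesis unfolding sees_upward_def by (meson UnCI UnE)
qed

lemma not_sees_x_disjoint:
  assumes "x_disjoint B C"
  shows "\<not> sees \<A> B C"
proof
  assume "sees \<A> B C"
  then obtain l r c d where "l < r" "{l..r} \<times> {c} \<subseteq> B" "{l..r} \<times> {d} \<subseteq> C"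
    unfolding sees_def sees_upward_def by blast
  then have "(l, c) \<in> B" "(l, d) \<in> C" by auto
  then have "l \<in> fst ` B \<inter> fst ` C" by (metis IntI fst_conv image_eqI)
  then show False using assms unfolding x_disjoint_def by blast
qed

lemma bar_rep_Un_separated:
  assumes rep: "bar_rep V E \<phi>" "bar_rep V F \<psi>"
    and sep: "\<And>u v B C. u \<in> V \<Longrightarrow> v \<in> V \<Longrightarrow> B \<in> \<phi> u \<Longrightarrow> C \<in> \<psi> v \<Longrightarrow> x_disjoint B C"
  shows "bar_rep V (E \<union> F) (\<lambda>v. \<phi> v \<union> \<psi> v)"
proof (rule bar_repI)
  have sep': "x_disjoint C B" if "u \<in> V" "v \<in> V" "B \<in> \<phi> u" "C \<in> \<psi> v" for u v B C
    using sep[OF that] by (auto simp: x_disjoint_def)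
  have x_Int: "B \<inter> C = {}" if "x_disjoint B C" for B C
    using that by (auto simp: x_disjoint_def)
  fix u v B C
  assume "u \<in> V" "v \<in> V" "B \<in> \<phi> u \<union> \<psi> u" "C \<in> \<phi> v \<union> \<psi> v" "(u, B) \<noteq> (v, C)"
  then show "B \<inter> C = {}"
    using bar_repD(3)[OF rep(1), of u v B C] bar_repD(3)[OF rep(2), of u v B C]
      x_Int[OF sep, of u v B C] x_Int[OF sep', of v u C B] by blast
next
  have sep': "x_disjoint C B" if "u \<in> V" "v \<in> V" "B \<in> \<phi> u" "C \<in> \<psi> v" for u v B C
    using sep[OF that] by (auto simp: x_disjoint_def)
  fix u v assume uv: "u \<in> V" "v \<in> V" "u \<noteq> v"
  let ?A = "\<Union>w\<in>V. \<phi> w" and ?B = "\<Union>w\<in>V. \<psi> w"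
  have un: "(\<Union>w\<in>V. \<phi> w \<union> \<psi> w) = ?A \<union> ?B" by blast
  have 1: "sees (?A \<union> ?B) B C \<longleftrightarrow> sees ?A B C" if "B \<in> \<phi> u" "C \<in> \<phi> v" for B C
    using sees_upward_Un[of ?B B ?A C] sees_upward_Un[of ?B C ?A B] sep uv that
    unfolding sees_def by blast
  have 2: "sees (?A \<union> ?B) B C \<longleftrightarrow> sees ?B B C" if "B \<in> \<psi> u" "C \<in> \<psi> v" for B C
    using sees_upward_Un[of ?A B ?B C] sees_upward_Un[of ?A C ?B B] sep' uv that
    unfolding sees_def Un_commute[of ?A] by blast
  have 3: "\<not> sees (?A \<union> ?B) B C" if "B \<in> \<phi> u" "C \<in> \<psi> v" for B C
    using not_sees_x_disjoint[OF sep] uv that by blast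
  have 4: "\<not> sees (?A \<union> ?B) B C" if "B \<in> \<psi> u" "C \<in> \<phi> v" for B C
    using not_sees_x_disjoint[OF sep'] uv that by blast
  have "(\<exists>B\<in>\<phi> u \<union> \<psi> u. \<exists>C\<in>\<phi> v \<union> \<psi> v. sees (?A \<union> ?B) B C) \<longleftrightarrow>
      (\<exists>B\<in>\<phi> u. \<exists>C\<in>\<phi> v. sees ?A B C) \<or> (\<exists>B\<in>\<psi> u. \<exists>C\<in>\<psi> v. sees ?B B C)"
    using 1 2 3 4 by blast
  then show "{u, v} \<in> E \<union> F \<longleftrightarrow>
      (\<exists>B\<in>\<phi> u \<union> \<psi> u. \<exists>C\<in>\<phi> v \<union> \<psi> v. sees (\<Union>w\<in>V. \<phi> w \<union> \<psi> w) B C)"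
    unfolding un using bar_repD(4)[OF rep(1) uv] bar_repD(4)[OF rep(2) uv] by simp
qed (use bar_repD(1,2)[OF rep(1)] bar_repD(1,2)[OF rep(2)] in blast)+

lemma bar_rep_bounded:
  assumes "bar_rep V E \<phi>" "finite V"
  obtains M where "\<And>v B p. v \<in> V \<Longrightarrow> B \<in> \<phi> v \<Longrightarrow> p \<in> B \<Longrightarrow> \<bar>fst p\<bar> < M"
proof -
  have "\<exists>m. \<forall>p\<in>B. \<bar>fst p\<bar> < m" if "is_bar B" for B
  proof -
    obtain x y where "B = {x..x + 1} \<times> {y}" using \<open>is_bar B\<close> by (auto simp: is_bar_def)
    then show ?thesis by (intro exI[of _ "\<bar>x\<bar> + 2"]) auto
  qed
  then obtain m where m: "\<And>B p. is_bar B \<Longrightarrow> p \<in> B \<Longrightarrow> \<bar>fst p\<bar> < m B" by metis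
  let ?X = "m ` (\<Union>v\<in>V. \<phi> v)"
  have fin: "finite ?X" using assms(2) bar_repD(1)[OF assms(1)] by auto
  show ?thesis
  \<comment> \<open>If there are no bars, \<open>Max ?X\<close> is unspecified but the claim is
    vacuous.\<close>
  proof (rule that[of "Max ?X"])
    fix v B p assume "v \<in> V" "B \<in> \<phi> v" "p \<in> B"
    moreover from this have "m B \<le> Max ?X" using fin by (intro Max_ge) auto
    ultimately show "\<bar>fst p\<bar> < Max ?X"
      using m[of B p] bar_repD(2)[OF assms(1)] by fastforce
  qed
qed

lemma bar_rep_Un:
  assumes "bar_rep V E \<phi>" "bar_rep V F \<psi>" "finite V"
  shows "\<exists>\<chi>. bar_rep V (E \<union> F) \<chi> \<and> (\<forall>v\<in>V. card (\<chi> v) \<le> card (\<phi> v) + card (\<psi> v))"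
proof -
  obtain M where M: "\<And>v B p. v \<in> V \<Longrightarrow> B \<in> \<phi> v \<Longrightarrow> p \<in> B \<Longrightarrow> \<bar>fst p\<bar> < M"
    using bar_rep_bounded[OF assms(1,3)] by metis
  obtain N where N: "\<And>v B p. v \<in> V \<Longrightarrow> B \<in> \<psi> v \<Longrightarrow> p \<in> B \<Longrightarrow> \<bar>fst p\<bar> < N"
    using bar_rep_bounded[OF assms(2,3)] by metis
  \<comment> \<open>The first family lies strictly between \<open>- M\<close> and \<open>M\<close>;
    the translation moves the second to the right of \<open>M\<close>.\<close>
  let ?\<psi> = "\<lambda>v. shift (M + N) ` \<psi> v"
  have "bar_rep V (E \<union> F) (\<lambda>v. \<phi> v \<union> ?\<psi> v)"
  proof (rule bar_rep_Un_separated[OF assms(1) bar_rep_shift[OF assms(2)]])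
    fix u v B C assume *: "u \<in> V" "v \<in> V" "B \<in> \<phi> u" "C \<in> ?\<psi> v"
    then obtain C' where C': "C' \<in> \<psi> v" "C = shift (M + N) C'" by blast
    have "fst p \<noteq> fst q" if "p \<in> B" "q \<in> C" for p q
      using M[OF *(1,3) that(1)] N[OF *(2) C'(1), of "(fst q - (M + N), snd q)"] that C'
      by (auto simp: shift_def)
    then show "x_disjoint B C" by (force simp: x_disjoint_def)
  qed
  moreover have "card (\<phi> v \<union> ?\<psi> v) \<le> card (\<phi> v) + card (\<psi> v)" if "v \<in> V" for v
    using card_Un_le[of "\<phi> v" "?\<psi> v"] card_image_le[OF bar_repD(1)[OF assms(2) that], of "shift (M + N)"]
    by linarith
  ultimately show ?thesis by blast
qed

lemma bar_rep_UN:
  assumes "finite I" "finite V" "\<And>i. i \<in> I \<Longrightarrow> bar_rep V (F i) (\<phi> i)"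
  shows "\<exists>\<chi>. bar_rep V (\<Union>i\<in>I. F i) \<chi> \<and> (\<forall>v\<in>V. card (\<chi> v) \<le> (\<Sum>i\<in>I. card (\<phi> i v)))"
  using assms(1,3)
proof (induction I)
  case empty
  have "bar_rep V {} (\<lambda>_. {})" by (simp add: bar_rep_def)
  then show ?case by auto
next
  case (insert j I)
  then obtain \<chi> where \<chi>: "bar_rep V (\<Union>i\<in>I. F i) \<chi>" "\<forall>v\<in>V. card (\<chi> v) \<le> (\<Sum>i\<in>I. card (\<phi> i v))"
    by auto
  obtain \<chi>' where \<chi>': "bar_rep V (F j \<union> (\<Union>i\<in>I. F i)) \<chi>'"
    "\<forall>v\<in>V. card (\<chi>' v) \<le> card (\<phi> j v) + card (\<chi> v)"
    using bar_rep_Un[OF _ \<chi>(1) assms(2), of "F j" "\<phi> j"] insert.prems by blast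
  have "card (\<chi>' v) \<le> (\<Sum>i\<in>insert j I. card (\<phi> i v))" if "v \<in> V" for v
    using \<chi>(2) \<chi>'(2) that insert.hyps by fastforce
  then show ?case using \<chi>'(1) by auto
qed

section \<open>Representing forests and their unions\<close>

lemma component_sets_iff:
  assumes "simple_graph V F"
  shows "C \<in> component_sets V F \<longleftrightarrow> (\<exists>u\<in>V. C = {w. reachable_in F u w})"
proof -
  have "w \<in> V" if "u \<in> V" "reachable_in F u w" for u w
    using reachable_closed[OF that(2,1)] assms
    by (auto simp: simple_graph_def doubleton_eq_iff) (metis doubleton_eq_iff)
  then have "{w \<in> V. reachable_in F u w} = {w. reachable_in F u w}" if "u \<in> V" for u
    using that by blast
  then show ?thesis unfolding component_sets_def by auto
qed

text \<open>Each component is represented on its own, with no bars for vertices outside it. A vertex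
  lies in just one component, so the sum over components still counts at most one bar.\<close>

lemma ub_forest_bar_rep:
  assumes "ub_forest V F"
  shows "\<exists>\<phi>. bar_rep V F \<phi> \<and> (\<forall>v\<in>V. card (\<phi> v) \<le> 1)"
proof -
  have sg: "simple_graph V F" and ub: "\<And>C. C \<in> component_sets V F \<Longrightarrow> UBVT C (induced_edges F C)"
    using assms by (auto simp: ub_forest_def)
  have finV: "finite V" using sg by (simp add: simple_graph_def)
  let ?I = "component_sets V F"
  have sub: "C \<subseteq> V" if "C \<in> ?I" for C using that by (auto simp: component_sets_def)
  have "\<exists>\<phi>. unit_bar_rep 1 C (induced_edges F C) \<phi>" if "C \<in> ?I" for C
    using ub[OF that] by (simp add: UBVT_def)
  then obtain \<phi> where \<phi>: "\<And>C. C \<in> ?I \<Longrightarrow> unit_bar_rep 1 C (induced_edges F C) (\<phi> C)" by metis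
  define \<psi> where "\<psi> C v = (if v \<in> C then \<phi> C v else {})" for C v
  have "bar_rep V (induced_edges F C) (\<psi> C)" if C: "C \<in> ?I" for C
  proof -
    have rep: "bar_rep C (induced_edges F C) (\<phi> C)" using \<phi>[OF C] by (simp add: unit_bar_rep_iff)
    have un: "(\<Union>w\<in>V. \<psi> C w) = (\<Union>w\<in>C. \<phi> C w)" using sub[OF C] by (auto simp: \<psi>_def)
    show ?thesis
    proof (rule bar_repI)
      show "finite (\<psi> C v)" for v using bar_repD(1)[OF rep] by (simp add: \<psi>_def)
      show "is_bar B" if "B \<in> \<psi> C v" for v B
        using bar_repD(2)[OF rep] that by (auto simp: \<psi>_def split: if_splits)
      show "B \<inter> D = {}" if "B \<in> \<psi> C u" "D \<in> \<psi> C v" "(u, B) \<noteq> (v, D)" for u v B D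
        using bar_repD(3)[OF rep, of u v B D] that by (auto simp: \<psi>_def split: if_splits)
      show "{u, v} \<in> induced_edges F C \<longleftrightarrow>
          (\<exists>B\<in>\<psi> C u. \<exists>D\<in>\<psi> C v. sees (\<Union>w\<in>V. \<psi> C w) B D)" if "u \<noteq> v" for u v
      proof (cases "u \<in> C \<and> v \<in> C")
        case True
        then show ?thesis unfolding un using bar_repD(4)[OF rep _ _ that] by (simp add: \<psi>_def)
      next
        case False
        then show ?thesis by (auto simp: \<psi>_def induced_edges_def)
      qed
    qed
  qed
  moreover have "finite ?I" using finV by (simp add: component_sets_def)
  ultimately obtain \<chi> where \<chi>: "bar_rep V (\<Union>C\<in>?I. induced_edges F C) \<chi>"
    "\<forall>v\<in>V. card (\<chi> v) \<le> (\<Sum>C\<in>?I. card (\<psi> C v))"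
    using bar_rep_UN[OF _ finV, of ?I "induced_edges F" \<psi>] by blast
  have un: "(\<Union>C\<in>?I. induced_edges F C) = F"
  proof
    show "F \<subseteq> (\<Union>C\<in>?I. induced_edges F C)"
    proof
      fix e assume "e \<in> F"
      then obtain u v where e: "e = {u, v}" "u \<in> V" using sg by (auto simp: simple_graph_def)
      then have "e \<in> induced_edges F {w. reachable_in F u w}"
        using \<open>e \<in> F\<close> by (auto simp: induced_edges_def intro: reachable_edge)
      then show "e \<in> (\<Union>C\<in>?I. induced_edges F C)" using component_sets_iff[OF sg] e(2) by blast
    qed
  qed (auto simp: induced_edges_def)
  have "card (\<chi> v) \<le> 1" if v: "v \<in> V" for v
  proof -
    let ?C = "{w. reachable_in F v w}"
    have only: "C = ?C" if C: "C \<in> ?I" "v \<in> C" for C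
    proof -
      obtain u where "C = {w. reachable_in F u w}" using C(1) component_sets_iff[OF sg] by blast
      moreover from this have "reachable_in F u v" using C(2) by simp
      then have "reachable_in F u w \<longleftrightarrow> reachable_in F v w" for w
        using reachable_trans[of F u v w] reachable_trans[of F v u w] reachable_sym[of F u v] by blast
      ultimately show ?thesis by simp
    qed
    have C: "?C \<in> ?I" unfolding component_sets_iff[OF sg] by (rule bexI[of _ v]) (rule refl, rule v)
    have "(\<Sum>C\<in>?I. card (\<psi> C v)) = (\<Sum>C\<in>{?C}. card (\<psi> C v))"
    proof (rule sum.mono_neutral_right)
      show "\<forall>C\<in>?I - {?C}. card (\<psi> C v) = 0"
      proof
        fix C assume "C \<in> ?I - {?C}"
        then have "v \<notin> C" using only[of C] by blast
        then show "card (\<psi> C v) = 0" by (simp add: \<psi>_def)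
      qed
    qed (use C \<open>finite ?I\<close> in auto)
    also have "\<dots> \<le> 1" using \<phi>[OF C] by (simp add: \<psi>_def unit_bar_rep_def)
    finally show ?thesis using \<chi>(2) v by (meson order_trans)
  qed
  then show ?thesis using \<chi>(1) unfolding un by blast
qed

lemma decomposition_unit_bar_rep:
  assumes "finite V" "ub_forest_decomposition k V E F"
  shows "\<exists>\<phi>. unit_bar_rep k V E \<phi>"
proof -
  have "\<exists>\<phi>. bar_rep V (F i) \<phi> \<and> (\<forall>v\<in>V. card (\<phi> v) \<le> 1)" if "i \<in> {..<k}" for i
  proof (rule ub_forest_bar_rep)
    show "ub_forest V (F i)" using assms(2) that by (simp add: ub_forest_decomposition_def)
  qed
  then obtain \<phi> where \<phi>: "\<And>i. i \<in> {..<k} \<Longrightarrow> bar_rep V (F i) (\<phi> i)"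
    "\<And>i v. i \<in> {..<k} \<Longrightarrow> v \<in> V \<Longrightarrow> card (\<phi> i v) \<le> 1" by metis
  obtain \<chi> where \<chi>: "bar_rep V (\<Union>i<k. F i) \<chi>" "\<forall>v\<in>V. card (\<chi> v) \<le> (\<Sum>i<k. card (\<phi> i v))"
    using bar_rep_UN[of "{..<k}" V F \<phi>] assms(1) \<phi>(1) by blast
  have "card (\<chi> v) \<le> k" if "v \<in> V" for v
  proof -
    have "(\<Sum>i<k. card (\<phi> i v)) \<le> (\<Sum>i<k. 1)" using \<phi>(2) that by (intro sum_mono) auto
    then show ?thesis using \<chi>(2) that by fastforce
  qed
  moreover have "(\<Union>i<k. F i) = E" using assms(2) by (simp add: ub_forest_decomposition_def)
  ultimately show ?thesis using \<chi>(1) by (auto simp: unit_bar_rep_iff)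
qed


section \<open>Decomposing a represented tree\<close>

lemma is_cycle_mono: "is_cycle F xs \<Longrightarrow> F \<subseteq> E \<Longrightarrow> is_cycle E xs"
  by (auto simp: is_cycle_def)

lemma forest_component_is_tree:
  assumes tree: "is_tree V E" and "F \<subseteq> E" and C: "C \<in> component_sets V F"
  shows "is_tree C (induced_edges F C)"
proof -
  have sgE: "simple_graph V E" and "\<nexists>xs. is_cycle E xs" using tree by (auto simp: is_tree_def)
  then have sg: "simple_graph V F" using \<open>F \<subseteq> E\<close> by (auto simp: simple_graph_def)
  obtain u where u: "u \<in> V" "C = {w. reachable_in F u w}" using C component_sets_iff[OF sg] by blast
  have "C \<subseteq> V" using C by (auto simp: component_sets_def)
  have "conn F C" using conn_reachable_avoiding[of F UNIV u] u by (simp add: induced_edges_def)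
  moreover have "\<nexists>xs. is_cycle (induced_edges F C) xs"
    using \<open>\<nexists>xs. is_cycle E xs\<close> is_cycle_mono[of "induced_edges F C" _ E] \<open>F \<subseteq> E\<close>
    by (auto simp: induced_edges_def)
  moreover have "simple_graph C (induced_edges F C)"
    unfolding simple_graph_def
  proof
    show "finite C" using \<open>C \<subseteq> V\<close> sg by (auto simp: simple_graph_def intro: finite_subset)
    show "\<forall>e\<in>induced_edges F C. \<exists>u\<in>C. \<exists>v\<in>C. u \<noteq> v \<and> e = {u, v}"
      using sg by (fastforce simp: simple_graph_def induced_edges_def)
  qed
  moreover have "u \<in> C" using u by simp
  ultimately show ?thesis unfolding is_tree_def conn_def by blast
qed

text \<open>The forests are the colour classes. Within a component of a class, the local colouring
  conditions become the degree conditions under which the component embeds into the comb.\<close>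

lemma balanced_decomposition:
  assumes tree: "is_tree V E" and bal: "balanced t V E D"
  shows "\<exists>F. ub_forest_decomposition t V E F"
proof -
  obtain \<kappa> where \<kappa>: "\<And>v. v \<in> V \<Longrightarrow> local_colouring t {u. (u, v) \<in> D} {u. (v, u) \<in> D}
      (undirected_nbrs E D v) (\<lambda>u. \<kappa> {u, v})"
    using balanced_colouring[OF tree bal] by blast
  have D: "{u, v} \<in> E" "(v, u) \<notin> D" if "(u, v) \<in> D" for u v
    using bal that by (auto simp: balanced_def)
  have finV: "finite V" using tree by (auto simp: is_tree_def simple_graph_def)
  define F where "F c = {e \<in> E. \<kappa> e = c}" for c
  have lt: "\<kappa> e < t" if e: "e \<in> E" for e
  proof -
    obtain u v where uv: "e = {u, v}" "v \<in> V" using tree_edge_obtain[OF tree e] by metis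
    then have "u \<in> {u. (u, v) \<in> D} \<union> {u. (v, u) \<in> D} \<union> undirected_nbrs E D v" using e by auto
    then show ?thesis using \<kappa>[OF uv(2)] uv(1) unfolding local_colouring_def by blast
  qed
  have "UBVT C (induced_edges (F c) C)" if C: "C \<in> component_sets V (F c)" for c C
  proof -
    let ?F = "induced_edges (F c) C"
    have "F c \<subseteq> E" by (auto simp: F_def)
    then have treeC: "is_tree C ?F" using forest_component_is_tree[OF tree _ C] by blast
    have "C \<subseteq> V" using C by (auto simp: component_sets_def)
    \<comment> \<open>The orientation is restricted to the edges of the component; its undirected
      edges are then undirected in \<open>D\<close> as well.\<close>
    define D' where "D' = {(u, v). (u, v) \<in> D \<and> {u, v} \<in> ?F}"
    have FE: "e \<in> E" "\<kappa> e = c" if "e \<in> ?F" for e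
      using that by (auto simp: induced_edges_def F_def)
    have inV: "u \<in> V" "v \<in> V" if "{u, v} \<in> ?F" for u v
      using tree_edge[OF treeC that] \<open>C \<subseteq> V\<close> by auto
    have und: "undirected_nbrs ?F D' v \<subseteq> {w \<in> undirected_nbrs E D v. \<kappa> {w, v} = c}" for v
      using FE by (auto simp: D'_def insert_commute)
    have "\<exists>\<pi>. comb_embedding C ?F \<pi>"
    proof (rule comb_embedding_exists[OF treeC, of D'])
      show "{u, v} \<in> ?F \<and> (v, u) \<notin> D'" if "(u, v) \<in> D'" for u v
        using that D by (auto simp: D'_def)
      show "u = w" if "(v, u) \<in> D'" "(v, w) \<in> D'" for u v w
      proof -
        have *: "(v, u) \<in> D" "(v, w) \<in> D" "{v, u} \<in> ?F" "{v, w} \<in> ?F" using that by (auto simp: D'_def)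
        then have "inj_on (\<lambda>u. \<kappa> {u, v}) {u. (v, u) \<in> D}"
          using \<kappa>[of v] inV by (auto simp: local_colouring_def)
        moreover have "\<kappa> {u, v} = \<kappa> {w, v}" using FE(2)[OF *(3)] FE(2)[OF *(4)] by (simp add: insert_commute)
        ultimately show ?thesis using * by (auto dest: inj_onD)
      qed
      show "u = w" if "(u, v) \<in> D'" "(w, v) \<in> D'" for u v w
      proof -
        have *: "(u, v) \<in> D" "(w, v) \<in> D" "{u, v} \<in> ?F" "{w, v} \<in> ?F" using that by (auto simp: D'_def)
        then have "inj_on (\<lambda>u. \<kappa> {u, v}) {u. (u, v) \<in> D}"
          using \<kappa>[of v] inV by (auto simp: local_colouring_def)
        moreover have "\<kappa> {u, v} = \<kappa> {w, v}" using FE(2)[OF *(3)] FE(2)[OF *(4)] by simp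
        ultimately show ?thesis using * by (auto dest: inj_onD)
      qed
      show "w \<notin> undirected_nbrs ?F D' v" if "(u, v) \<in> D'" for u v w
      proof
        assume "w \<in> undirected_nbrs ?F D' v"
        then have w: "w \<in> undirected_nbrs E D v" "\<kappa> {w, v} = c" using und[of v] by blast+
        have u: "(u, v) \<in> D" "{u, v} \<in> ?F" using that by (auto simp: D'_def)
        then have "\<kappa> {u, v} \<noteq> \<kappa> {w, v}"
          using \<kappa>[OF inV(2)[OF u(2)]] w unfolding local_colouring_def by blast
        then show False using FE(2)[OF u(2)] w by simp
      qed
      show "card (undirected_nbrs ?F D' v) \<le> 2" if "v \<in> C" for v
      proof -
        have "v \<in> V" using that \<open>C \<subseteq> V\<close> by blast
        have "finite (undirected_nbrs E D v)"
          using tree_edge[OF tree] by (intro finite_subset[OF _ finV]) auto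
        then have "card (undirected_nbrs ?F D' v) \<le> card {w \<in> undirected_nbrs E D v. \<kappa> {w, v} = c}"
          by (rule card_mono[OF rev_finite_subset und]) blast
        also have "\<dots> \<le> 2" using \<kappa>[OF \<open>v \<in> V\<close>] by (simp add: local_colouring_def)
        finally show ?thesis .
      qed
    qed
    then show ?thesis using comb_embedding_unit_bar_rep treeC by (auto simp: UBVT_def)
  qed
  moreover have "simple_graph V (F c)" for c
    using tree by (auto simp: is_tree_def simple_graph_def F_def)
  ultimately have "ub_forest_decomposition t V E F"
    unfolding ub_forest_decomposition_def ub_forest_def using lt by (auto simp: F_def)
  then show ?thesis by blast
qed

theorem theorem4:
  fixes V :: "'a set" and E :: "'a set set"
  assumes "is_tree V E"
  shows "ub V E = ub_arboricity V E"
proof -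
  have "finite V" using assms by (auto simp: is_tree_def simple_graph_def)
  \<comment> \<open>Both numbers are least values of \<open>t\<close>, and the two defining
    predicates agree for every \<open>t\<close>.\<close>
  then have "(\<exists>\<phi>. unit_bar_rep t V E \<phi>) \<longleftrightarrow> (\<exists>F. ub_forest_decomposition t V E F)" for t
    using unit_bar_rep_balanced[OF assms] balanced_decomposition[OF assms]
      decomposition_unit_bar_rep by blast
  then show ?thesis by (simp add: ub_def ub_arboricity_def)
qed

end
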